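(* Let $T:X\to X$ be an adjoint operator on a (real or complex) separable dual Banach space $X$. Then $$\overline{\operatorname{FRec}(T)}=\overline{\operatorname{RRec}(T)}$$ (closures in the norm topology). Moreover: (a) The following statements are equivalent: (i) $\operatorname{FRec}(T)\setminus\{0\}\neq\varnothing$; (ii) $\operatorname{UFRec}(T)\setminus\{0\}\neq\varnothing$; (iii) $\operatorname{RRec}(T)\setminus\{0\}\neq\varnothing$; (iv) $T$ admits a non-trivial invariant probability measure. (b) The following statements are equivalent: (i) $T$ is frequently recurrent; (ii) $T$ is $\mathcal{U}$-frequently recurrent; (iii) $T$ is reiteratively recurrent; (iv) $T$ admits an invariant probability measure with full support. In particular, these results hold whenever $T$ is a bounded linear operator on a (real or complex) separable reflexive Banach space $X$.
   Context: $\mathbb{N}_0=\{0,1,2,\dots\}$. "Adjoint operator on a separable dual Banach space" means: $X=Y^*$ is the dual of a Banach space $Y$, $X$ is norm-separable, and $T=S^*$ for some bounded linear operator $S:Y\to Y$. For $x\in X$, $A\subset X$, let $N(x,A)=\{n\in\mathbb{N}_0: T^nx\in A\}$. For $A\subset\mathbb{N}_0$: - lower density: $\underline{\operatorname{dens}}(A)=\liminf_{N\to\infty}\frac{\operatorname{card}(A\cap[0,N])}{N+1}$; - upper density: $\overline{\operatorname{dens}}(A)=\limsup_{N\to\infty}\frac{\operatorname{card}(A\cap[0,N])}{N+1}$; - upper Banach density: $\overline{\operatorname{Bd}}(A)=\limsup_{N\to\infty}\left(\max_{m\ge0}\frac{\operatorname{card}(A\cap[m,m+N])}{N+1}\right)$.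 A point $x$ is frequently recurrent (resp. $\mathcal{U}$-frequently recurrent, resp. reiteratively recurrent) if $\underline{\operatorname{dens}}(N(x,U))>0$ (resp. $\overline{\operatorname{dens}}(N(x,U))>0$, resp. $\overline{\operatorname{Bd}}(N(x,U))>0$) for every (norm) neighbourhood $U$ of $x$. The sets of such points are denoted $\operatorname{FRec}(T)$, $\operatorname{UFRec}(T)$, $\operatorname{RRec}(T)$ respectively. The map $T$ is called frequently (resp. $\mathcal{U}$-frequently, reiteratively) recurrent if $\operatorname{FRec}(T)$ (resp. $\operatorname{UFRec}(T)$, $\operatorname{RRec}(T)$) is dense in $X$. An invariant probability measure is a Borel probability measure $\mu$ on $X$ (for the norm topology) with $\mu(T^{-1}(A))=\mu(A)$ for all Borel sets $A$. It is non-trivial if $\mu\neq\delta_0$ (the Dirac mass at $0$), and has full support if $\mu(U)>0$ for every non-empty open set $U\subset X$. *)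

theory Defs
  imports "HOL-Probability.Probability"
begin

(* Scalars are any 'k :: {real_normed_field, euclidean_space}. Both real and complex are instances,
   and by Frobenius' theorem they are the only ones up to isometric isomorphism, so quantifying over
   'k is exactly "real or complex".  The libraries have no class of complex normed spaces; hence a
   Banach space over 'k is a type of class banach (its underlying real Banach space) with a scalar
   multiplication by 'k that extends scaleR. *)

locale banach_space_over = vector_space smul
  for smul :: "'k::{real_normed_field, euclidean_space} \<Rightarrow> 'x::banach \<Rightarrow> 'x" +
  assumes norm_smul: "norm (smul c x) = norm c * norm x"
    and smul_of_real: "smul (of_real r) x = r *\<^sub>R x"

definition bounded_operator :: "('k::{real_normed_field, euclidean_space} \<Rightarrow> 'x::banach \<Rightarrow> 'x)
    \<Rightarrow> ('x \<Rightarrow> 'x) \<Rightarrow> bool" where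
  "bounded_operator smul T \<longleftrightarrow>
     Vector_Spaces.linear smul smul T \<and> (\<exists>B. \<forall>x. norm (T x) \<le> B * norm x)"

(* The elements of 'y \<Rightarrow>\<^sub>L 'k are only required to be real-linear, so the topological dual is the
   subset of the 'k-linear ones. Its norm is the operator norm that it inherits. *)

definition dual_space :: "('k::{real_normed_field, euclidean_space} \<Rightarrow> 'y::banach \<Rightarrow> 'y)
    \<Rightarrow> ('y \<Rightarrow>\<^sub>L 'k) set" where
  "dual_space smul = {f. Vector_Spaces.linear smul (*) (blinfun_apply f)}"

(* (c f)(y) = c * f y *)
definition dual_scale :: "'k::{real_normed_field, euclidean_space} \<Rightarrow> ('y::banach \<Rightarrow>\<^sub>L 'k)
    \<Rightarrow> ('y \<Rightarrow>\<^sub>L 'k)" where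
  "dual_scale c f = blinfun_mult_right c o\<^sub>L f"

(* J identifies X with the dual of Y. *)
definition dual_identification :: "('k::{real_normed_field, euclidean_space} \<Rightarrow> 'x::banach \<Rightarrow> 'x)
    \<Rightarrow> ('k \<Rightarrow> 'y::banach \<Rightarrow> 'y) \<Rightarrow> ('x \<Rightarrow> 'y \<Rightarrow>\<^sub>L 'k) \<Rightarrow> bool" where
  "dual_identification scaleX scaleY J \<longleftrightarrow>
     Vector_Spaces.linear scaleX dual_scale J \<and> (\<forall>x. norm (J x) = norm x) \<and>
     range J = dual_space scaleY"

(* T is the adjoint of S when X is identified with the dual of Y through J. *)
definition adjoint_of :: "('x::banach \<Rightarrow> 'y::banach \<Rightarrow>\<^sub>L 'k::{real_normed_field, euclidean_space})
    \<Rightarrow> ('x \<Rightarrow> 'x) \<Rightarrow> ('y \<Rightarrow> 'y) \<Rightarrow> bool" where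
  "adjoint_of J T S \<longleftrightarrow> (\<forall>x y. blinfun_apply (J (T x)) y = blinfun_apply (J x) (S y))"

(* Bounded linear functionals on the dual; values outside dual_space are irrelevant. *)
definition bidual_functional :: "('k::{real_normed_field, euclidean_space} \<Rightarrow> 'x::banach \<Rightarrow> 'x)
    \<Rightarrow> (('x \<Rightarrow>\<^sub>L 'k) \<Rightarrow> 'k) \<Rightarrow> bool" where
  "bidual_functional smul \<phi> \<longleftrightarrow>
     (\<forall>f\<in>dual_space smul. \<forall>g\<in>dual_space smul. \<phi> (f + g) = \<phi> f + \<phi> g) \<and>
     (\<forall>c. \<forall>f\<in>dual_space smul. \<phi> (dual_scale c f) = c * \<phi> f) \<and>
     (\<exists>B. \<forall>f\<in>dual_space smul. norm (\<phi> f) \<le> B * norm f)"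

(* Surjectivity of the canonical embedding into the bidual. *)
definition reflexive_space :: "('k::{real_normed_field, euclidean_space} \<Rightarrow> 'x::banach \<Rightarrow> 'x)
    \<Rightarrow> bool" where
  "reflexive_space smul \<longleftrightarrow>
     (\<forall>\<phi>. bidual_functional smul \<phi> \<longrightarrow> (\<exists>x. \<forall>f\<in>dual_space smul. \<phi> f = blinfun_apply f x))"

definition lower_density :: "nat set \<Rightarrow> ereal" where
  "lower_density A = liminf (\<lambda>N. ereal (real (card (A \<inter> {0..N})) / real (N + 1)))"

definition upper_density :: "nat set \<Rightarrow> ereal" where
  "upper_density A = limsup (\<lambda>N. ereal (real (card (A \<inter> {0..N})) / real (N + 1)))"

(* For fixed N the quotient takes only finitely many values, so the supremum is a maximum. *)
definition upper_Banach_density :: "nat set \<Rightarrow> ereal" where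
  "upper_Banach_density A =
     limsup (\<lambda>N. SUP m. ereal (real (card (A \<inter> {m..m + N})) / real (N + 1)))"

definition return_set :: "('x \<Rightarrow> 'x) \<Rightarrow> 'x \<Rightarrow> 'x set \<Rightarrow> nat set" where
  "return_set T x A = {n. (T ^^ n) x \<in> A}"

definition FRec :: "('x::topological_space \<Rightarrow> 'x) \<Rightarrow> 'x set" where
  "FRec T = {x. \<forall>U. x \<in> interior U \<longrightarrow> 0 < lower_density (return_set T x U)}"

definition UFRec :: "('x::topological_space \<Rightarrow> 'x) \<Rightarrow> 'x set" where
  "UFRec T = {x. \<forall>U. x \<in> interior U \<longrightarrow> 0 < upper_density (return_set T x U)}"

definition RRec :: "('x::topological_space \<Rightarrow> 'x) \<Rightarrow> 'x set" where
  "RRec T = {x. \<forall>U. x \<in> interior U \<longrightarrow> 0 < upper_Banach_density (return_set T x U)}"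

definition frequently_recurrent :: "('x::topological_space \<Rightarrow> 'x) \<Rightarrow> bool" where
  "frequently_recurrent T \<longleftrightarrow> closure (FRec T) = UNIV"

definition U_frequently_recurrent :: "('x::topological_space \<Rightarrow> 'x) \<Rightarrow> bool" where
  "U_frequently_recurrent T \<longleftrightarrow> closure (UFRec T) = UNIV"

definition reiteratively_recurrent :: "('x::topological_space \<Rightarrow> 'x) \<Rightarrow> bool" where
  "reiteratively_recurrent T \<longleftrightarrow> closure (RRec T) = UNIV"

definition invariant_probability :: "('x::topological_space \<Rightarrow> 'x) \<Rightarrow> 'x measure \<Rightarrow> bool" where
  "invariant_probability T \<mu> \<longleftrightarrow> sets \<mu> = sets borel \<and> prob_space \<mu> \<and>
     (\<forall>A\<in>sets borel. emeasure \<mu> (T -` A) = emeasure \<mu> A)"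

definition full_support :: "'x::topological_space measure \<Rightarrow> bool" where
  "full_support \<mu> \<longleftrightarrow> (\<forall>U. open U \<longrightarrow> U \<noteq> {} \<longrightarrow> 0 < emeasure \<mu> U)"

end

theory Submission
  imports Defs
begin

text \<open>
  The three kinds of recurrent points are nested, so the theorem amounts to passing from a reiteratively
  recurrent point to an invariant measure and from an invariant measure to frequently recurrent points.

  From measures to points: if \<open>\<mu>\<close> is invariant, then almost every point of a set \<open>U\<close> visits \<open>U\<close> with
  positive lower frequency (\<open>AE_positive_visit_frequency\<close>). This is a consequence of the maximal ergodic
  theorem. Separability turns it into the statement that \<open>\<mu>\<close>-almost every point is frequently
  recurrent (\<open>AE_frequently_recurrent\<close>).

  From points to measures: let \<open>x\<close> be reiteratively recurrent and \<open>K\<close> a closed ball around it. Along windows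
  in which the orbit visits \<open>K\<close> with frequency bounded below, the empirical frequencies have a cluster
  point by Tychonoff's theorem. This is a finitely additive invariant set function with
  positive value at \<open>K\<close> (\<open>orbit_charge\<close>). The orbit need not be bounded, and the part of the mass that escapes
  to infinity is discarded; what remains is still invariant, because \<open>T\<close> cannot send mass from a
  bounded set to infinity (\<open>tight_charge\<close>).

  It remains to replace the set function by a measure. The norm balls are compact for the weak-star topology, and
  \<open>T\<close> is continuous for it because \<open>T\<close> is an adjoint. The sets that are, together with their complements, inner
  regular for weak-star closed sets form an invariant algebra, on which compactness gives countable
  additivity (\<open>jordan_continuous_at_empty\<close>). All but countably many levels of a weak-star continuous function give
  sets in this algebra, so the generated sigma-algebra contains the norm balls and, as the space is separable,
  all Borel sets. Caratheodory's extension is the required measure, and it charges \<open>K\<close>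
  (\<open>invariant_probability_of_charge\<close>).

  A reflexive space is treated as the dual of its dual. To cover both cases uniformly, the argument is carried out for
  an abstract pairing (\<open>norm_pairing\<close>). The reflexive case needs functionals that attain their norm at a given
  point, that is, the Hahn-Banach theorem over the scalar field (\<open>norming_functional\<close>).
\<close>

section \<open>Visit frequencies under an invariant measure\<close>

lemma ex_small_ball_from_dense:
  fixes D :: "'x::metric_space set"
  assumes D: "closure D = UNIV" and U: "open U" "x \<in> U"
  shows "\<exists>c\<in>D. \<exists>k. x \<in> ball c (1 / real (Suc k)) \<and> cball c (1 / real (Suc k)) \<subseteq> U"
proof -
  obtain e where e: "e > 0" "ball x e \<subseteq> U" using U open_contains_ball by blast
  obtain k where k: "1 / real (Suc k) < e / 2" using nat_approx_posE[of "e/2"] e(1) by auto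
  have "x \<in> closure D" using D by simp
  moreover have "0 < 1 / real (Suc k)" by simp
  ultimately obtain c where c: "c \<in> D" "dist c x < 1 / real (Suc k)"
    unfolding closure_approachable by blast
  have "cball c (1 / real (Suc k)) \<subseteq> ball x e"
  proof
    fix y assume "y \<in> cball c (1 / real (Suc k))"
    then show "y \<in> ball x e" using c(2) k dist_triangle[of x y c] by (simp add: dist_commute)
  qed
  with e(2) c show ?thesis by (intro bexI[of _ c] exI[of _ k]) auto
qed

text \<open>The maximum of the Birkhoff sums of length at most \<open>N\<close>, the empty sum included. The recursion along
the orbit is the form in which the maximal inequality uses it: wherever the maximum is positive, it
equals \<open>g x\<close> plus the maximum of order \<open>N - 1\<close> at \<open>T x\<close>.\<close>

fun max_birkhoff :: "('a \<Rightarrow> 'a) \<Rightarrow> ('a \<Rightarrow> real) \<Rightarrow> nat \<Rightarrow> 'a \<Rightarrow> real" where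
  "max_birkhoff T g 0 x = 0"
| "max_birkhoff T g (Suc N) x = max 0 (g x + max_birkhoff T g N (T x))"

lemma max_birkhoff_Suc_mono: "max_birkhoff T g N x \<le> max_birkhoff T g (Suc N) x"
proof (induction N arbitrary: x)
  case (Suc N)
  from Suc[of "T x"] show ?case by (simp add: max_def)
qed simp

lemma birkhoff_sum_Suc:
  "(\<Sum>i<Suc n. g ((T ^^ i) x)) = g x + (\<Sum>i<n. g ((T ^^ i) (T x)))"
  unfolding sum.lessThan_Suc_shift by (simp add: funpow_swap1)

lemma birkhoff_sum_le_max_birkhoff:
  "n \<le> N \<Longrightarrow> (\<Sum>i<n. g ((T ^^ i) x)) \<le> max_birkhoff T g N x"
proof (induction N arbitrary: n x)
  case (Suc N)
  show ?case
  proof (cases n)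
    case (Suc m)
    then have "(\<Sum>i<m. g ((T ^^ i) (T x))) \<le> max_birkhoff T g N (T x)"
      using Suc.prems Suc.IH[of m "T x"] by simp
    then show ?thesis
      unfolding Suc birkhoff_sum_Suc by simp
  qed simp
qed simp

lemma max_birkhoff_bounded:
  assumes "\<And>x. \<bar>g x\<bar> \<le> K"
  shows "\<bar>max_birkhoff T g N x\<bar> \<le> real N * K"
proof (induction N arbitrary: x)
  case (Suc N)
  from Suc[of "T x"] assms[of x] show ?case by (auto simp: algebra_simps max_def abs_le_iff)
qed simp

lemma max_birkhoff_measurable:
  assumes [measurable]: "T \<in> measurable M M" "g \<in> borel_measurable M"
  shows "max_birkhoff T g N \<in> borel_measurable M"
proof (induction N)
  case (Suc N)
  note Suc[measurable]
  show ?case by simp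
qed simp

text \<open>Garsia's argument for the maximal ergodic theorem. On \<open>E\<close> the function \<open>g\<close> is the difference between
the maximum of order \<open>N + 1\<close> and the maximum of order \<open>N\<close> at \<open>T x\<close>; off \<open>E\<close> this difference is not
positive. The integral of the difference is nonnegative because the measure is invariant and the
maxima increase with their order.\<close>

theorem (in prob_space) maximal_ergodic:
  assumes T [measurable]: "T \<in> measurable M M" and inv: "distr M M T = M"
    and g [measurable]: "g \<in> borel_measurable M" and bound: "\<And>x. \<bar>g x\<bar> \<le> K"
  fixes N defines "E \<equiv> {x \<in> space M. 0 < max_birkhoff T g (Suc N) x}"
  shows "0 \<le> (\<integral>x. indicator E x * g x \<partial>M)"
proof -
  let ?p = "max_birkhoff T g"
  note max_birkhoff_measurable[OF T g, measurable]
  have [measurable]: "E \<in> sets M" unfolding E_def by measurable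
  have int: "integrable M (?p n)" for n
    by (rule integrable_const_bound[where B = "real n * K"])
       (auto intro!: AE_I2 max_birkhoff_bounded bound)
  have intT: "integrable M (\<lambda>x. ?p n (T x))" for n
    by (rule integrable_const_bound[where B = "real n * K"])
       (auto intro!: AE_I2 max_birkhoff_bounded bound)
  have intg: "integrable M (\<lambda>x. indicator E x * g x)"
    by (rule integrable_const_bound[where B = K])
       (use bound order_trans[OF abs_ge_zero bound] in \<open>auto simp: indicator_def\<close>)
  have nonneg: "0 \<le> ?p n x" for n x by (cases n) auto
  have "(\<integral>x. ?p (Suc N) x \<partial>M) - (\<integral>x. ?p N (T x) \<partial>M) = (\<integral>x. ?p (Suc N) x - ?p N (T x) \<partial>M)"
    by (rule Bochner_Integration.integral_diff[symmetric]) (rule int intT)+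
  also have "\<dots> \<le> (\<integral>x. indicator E x * g x \<partial>M)"
  proof (rule integral_mono[OF Bochner_Integration.integrable_diff[OF int intT] intg])
    fix x assume "x \<in> space M"
    then show "?p (Suc N) x - ?p N (T x) \<le> indicator E x * g x"
      using nonneg[of N "T x"] by (auto simp: E_def indicator_def max_def)
  qed
  finally have "(\<integral>x. ?p (Suc N) x \<partial>M) - (\<integral>x. ?p N (T x) \<partial>M) \<le> (\<integral>x. indicator E x * g x \<partial>M)" .
  moreover have "(\<integral>x. ?p N (T x) \<partial>M) = (\<integral>x. ?p N x \<partial>M)"
    using integral_distr[OF T, of "?p N"] inv by simp
  moreover have "(\<integral>x. ?p N x \<partial>M) \<le> (\<integral>x. ?p (Suc N) x \<partial>M)"
    by (rule integral_mono[OF int int max_birkhoff_Suc_mono])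
  ultimately show ?thesis by linarith
qed

definition visits :: "('a \<Rightarrow> 'a) \<Rightarrow> 'a set \<Rightarrow> nat \<Rightarrow> 'a \<Rightarrow> real" where
  "visits T U n x = (\<Sum>i<n. indicator U ((T ^^ i) x))"

lemma visits_measurable:
  assumes [measurable]: "T \<in> measurable M M" "U \<in> sets M"
  shows "visits T U n \<in> borel_measurable M"
proof -
  have [measurable]: "(T ^^ i) \<in> measurable M M" for i
  proof (induction i)
    case 0 show ?case by (simp add: id_def)
  next
    case (Suc i)
    note Suc[measurable]
    show ?case by (simp add: comp_def)
  qed
  show ?thesis unfolding visits_def by measurable
qed

text \<open>Let \<open>B\<close> be the set of
points whose frequency of visits has lower limit zero. It is mapped into itself, so along an
orbit starting in \<open>B\<close> the Birkhoff sums of \<open>1\<^sub>B (\<epsilon> - 1\<^sub>U)\<close> become positive, whatever \<open>\<epsilon> > 0\<close> is. The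
maximal ergodic theorem then bounds the measure of \<open>B \<inter> U\<close> by \<open>\<epsilon>\<close>.\<close>

theorem (in prob_space) AE_positive_visit_frequency:
  assumes T [measurable]: "T \<in> measurable M M" and inv: "distr M M T = M"
    and U [measurable]: "U \<in> sets M"
  shows "AE x in M. x \<in> U \<longrightarrow> (\<exists>k. \<exists>m. \<forall>n\<ge>m. real n / real (Suc k) \<le> visits T U n x)"
proof -
  note visits_measurable[OF T U, measurable]
  define B where "B = {x \<in> space M. \<forall>k. \<forall>m. \<exists>n\<ge>m. visits T U n x < real n / real (Suc k)}"
  have [measurable]: "B \<in> sets M" unfolding B_def by measurable
  have space: "T x \<in> space M" if "x \<in> space M" for x
    using measurable_space[OF T that] .
  have "B \<subseteq> space M" unfolding B_def by (rule Collect_restrict)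
  then have B_space: "x \<in> space M" if "x \<in> B" for x using that by (rule subsetD)
  have B_rare: "\<exists>n\<ge>m. visits T U n x < real n / real (Suc k)" if "x \<in> B" for x k m
    using CollectD[OF that[unfolded B_def]] by (elim conjE allE)
  have TB: "T x \<in> B" if x: "x \<in> B" for x
    unfolding B_def
  proof (safe)
    show "T x \<in> space M" by (rule space[OF B_space[OF x]])
    fix k m
    \<comment> \<open>The visits of \<open>T x\<close> up to time \<open>n - 1\<close> are among those of \<open>x\<close> up to time \<open>n\<close>. The shift by one in
      the length is absorbed by asking twice as much of \<open>x\<close>.\<close>
    obtain n where n: "n \<ge> Suc (Suc m)" "visits T U n x < real n / real (Suc (2 * k + 1))"
      using B_rare[OF x] by blast
    then obtain j where j: "n = Suc j" "j \<ge> Suc m" using Suc_le_D by auto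
    have "visits T U j (T x) \<le> visits T U n x"
      unfolding visits_def j birkhoff_sum_Suc by simp
    also have "\<dots> < real n / real (Suc (2 * k + 1))" by (rule n)
    also have "\<dots> \<le> 2 * real j / real (Suc (2 * k + 1))"
      using j by (intro divide_right_mono) auto
    also have "\<dots> = real j / real (Suc k)" by (simp add: field_simps)
    finally show "\<exists>n\<ge>m. visits T U n (T x) < real n / real (Suc k)" using j(2) by (intro exI[of _ j]) auto
  qed
  have iter: "(T ^^ i) x \<in> B" if "x \<in> B" for i x by (induction i) (use that TB in auto)
  have "prob (B \<inter> U) \<le> 1 / real (Suc k)" for k
  proof -
    define \<epsilon> where "\<epsilon> = 1 / real (Suc k)"
    have \<epsilon>: "0 < \<epsilon>" "\<epsilon> \<le> 1" by (auto simp: \<epsilon>_def)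
    define g where "g x = indicator B x * (\<epsilon> - indicator U x)" for x
    have g [measurable]: "g \<in> borel_measurable M" unfolding g_def by measurable
    have gb: "\<bar>g x\<bar> \<le> 1" for x using \<epsilon> by (auto simp: g_def indicator_def)
    note max_birkhoff_measurable[OF T g, measurable]
    define E where "E N = {x \<in> space M. 0 < max_birkhoff T g (Suc N) x}" for N
    have [measurable]: "E N \<in> sets M" for N unfolding E_def by measurable
    have int: "integrable M (indicator A :: _ \<Rightarrow> real)" if "A \<in> sets M" for A
      using that by (intro integrable_real_indicator) (auto simp: emeasure_eq_measure)
    have le: "prob (B \<inter> U \<inter> E N) \<le> \<epsilon>" for N
    proof -
      have "0 \<le> (\<integral>x. indicator (E N) x * g x \<partial>M)"
        unfolding E_def by (rule maximal_ergodic[OF T inv g gb])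
      also have "\<dots> = (\<integral>x. \<epsilon> * indicator (B \<inter> E N) x - indicator (B \<inter> U \<inter> E N) x \<partial>M)"
        by (rule Bochner_Integration.integral_cong) (auto simp: g_def indicator_def)
      also have "\<dots> = \<epsilon> * prob (B \<inter> E N) - prob (B \<inter> U \<inter> E N)"
        by (subst Bochner_Integration.integral_diff) (auto intro!: int integrable_mult_right)
      finally have "prob (B \<inter> U \<inter> E N) \<le> \<epsilon> * prob (B \<inter> E N)" by simp
      also have "\<dots> \<le> \<epsilon>" using \<epsilon> by (simp add: mult_left_le)
      finally show ?thesis .
    qed
    have "incseq (\<lambda>N. B \<inter> U \<inter> E N)"
    proof (rule incseq_SucI)
      fix N show "B \<inter> U \<inter> E N \<subseteq> B \<inter> U \<inter> E (Suc N)"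
        unfolding E_def using max_birkhoff_Suc_mono[of T g "Suc N"] by (auto intro: less_le_trans)
    qed
    then have "(\<lambda>N. prob (B \<inter> U \<inter> E N)) \<longlonglongrightarrow> prob (\<Union>N. B \<inter> U \<inter> E N)"
      by (intro finite_Lim_measure_incseq) auto
    also have "(\<Union>N. B \<inter> U \<inter> E N) = B \<inter> U"
    proof safe
      fix x assume x: "x \<in> B" "x \<in> U"
      obtain n where n: "n \<ge> Suc 0" "visits T U n x < real n / real (Suc k)"
        using B_rare[OF x(1)] by blast
      then obtain N where N: "n = Suc N" using Suc_le_D by auto
      have "0 < real n * \<epsilon> - visits T U n x" using n(2) by (simp add: \<epsilon>_def)
      also have "\<dots> = (\<Sum>i<n. g ((T ^^ i) x))"
        using iter[OF x(1)] by (simp add: visits_def g_def sum_subtractf)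
      also have "\<dots> \<le> max_birkhoff T g (Suc N) x"
        by (rule birkhoff_sum_le_max_birkhoff) (simp add: N)
      finally have "x \<in> E N" using B_space[OF x(1)] by (simp add: E_def)
      then show "x \<in> (\<Union>N. B \<inter> U \<inter> E N)" using x by auto
    qed
    finally show ?thesis using le LIMSEQ_le_const2 unfolding \<epsilon>_def by blast
  qed
  then have "\<not> prob (B \<inter> U) > 0" using nat_approx_posE by (metis not_le)
  then have "prob (B \<inter> U) = 0" using measure_nonneg[of M "B \<inter> U"] by simp
  then have "B \<inter> U \<in> null_sets M" by (simp add: null_sets_def emeasure_eq_measure)
  then have "AE x in M. x \<notin> B \<inter> U" by (rule AE_not_in)
  then show ?thesis
    by (rule AE_mp) (auto simp: B_def not_less intro!: AE_I2)
qed

lemma card_return_set: "real (card (return_set T x U \<inter> {0..N})) = visits T U (Suc N) x"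
proof -
  have "return_set T x U \<inter> {0..N} = {i \<in> {..<Suc N}. (T ^^ i) x \<in> U}"
    by (auto simp: return_set_def)
  moreover have "real (card {i \<in> {..<Suc N}. (T ^^ i) x \<in> U}) = visits T U (Suc N) x"
    unfolding visits_def 
    by (simp add: indicator_def sum.If_cases Int_def del: sum.lessThan_Suc)
  ultimately show ?thesis by simp
qed

lemma lower_density_pos:
  assumes "\<forall>n\<ge>m. real n / real (Suc k) \<le> visits T U n x"
  shows "0 < lower_density (return_set T x U)"
proof -
  have "ereal (1 / real (Suc k)) \<le> lower_density (return_set T x U)"
    unfolding lower_density_def card_return_set
  proof (rule Liminf_bounded)
    show "\<forall>\<^sub>F N in sequentially. ereal (1 / real (Suc k)) \<le> ereal (visits T U (Suc N) x / real (N + 1))"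
      using eventually_ge_at_top[of m]
    proof eventually_elim
      case (elim N)
      then show ?case using assms[rule_format, of "Suc N"] by (simp add: field_simps)
    qed
  qed
  then show ?thesis by (rule less_le_trans[rotated]) simp
qed

lemma lower_density_mono:
  assumes "A \<subseteq> B"
  shows "lower_density A \<le> lower_density B"
  unfolding lower_density_def
  by (intro Liminf_mono always_eventually allI)
     (use assms in \<open>auto intro!: divide_right_mono card_mono\<close>)

lemma return_set_mono: "U \<subseteq> V \<Longrightarrow> return_set T x U \<subseteq> return_set T x V"
  by (auto simp: return_set_def)

text \<open>A countable family of balls with centres in \<open>D\<close> refines every neighbourhood, so the
exceptional null sets of these balls suffice.\<close>

theorem AE_frequently_recurrent:
  fixes T :: "'x::metric_space \<Rightarrow> 'x"
  assumes D: "countable D" "closure D = (UNIV :: 'x set)" and T: "continuous_on UNIV T"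
    and \<mu>: "invariant_probability T \<mu>"
  shows "AE x in \<mu>. x \<in> FRec T"
proof -
  interpret prob_space \<mu> using \<mu> by (simp add: invariant_probability_def)
  have sets: "sets \<mu> = sets borel" using \<mu> by (simp add: invariant_probability_def)
  then have space: "space \<mu> = UNIV" using sets_eq_imp_space_eq[of \<mu> borel] by simp
  have meas: "T \<in> measurable \<mu> \<mu>"
    using borel_measurable_continuous_onI[OF T] measurable_cong_sets[OF sets sets] by auto
  have distr: "distr \<mu> \<mu> T = \<mu>"
    by (rule measure_eqI) (use \<mu> in \<open>auto simp: emeasure_distr[OF meas] sets space invariant_probability_def\<close>)
  have "AE x in \<mu>. \<forall>c\<in>D. \<forall>j. x \<in> ball c (1 / real (Suc j)) \<longrightarrow>
      (\<exists>k. \<exists>m. \<forall>n\<ge>m. real n / real (Suc k) \<le> visits T (ball c (1 / real (Suc j))) n x)"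
    unfolding AE_ball_countable[OF D(1)] AE_all_countable
    by (intro ballI allI AE_positive_visit_frequency meas distr) (simp add: sets)
  then show ?thesis
  proof (rule AE_mp, intro AE_I2 impI)
    fix x
    assume *: "\<forall>c\<in>D. \<forall>j. x \<in> ball c (1 / real (Suc j)) \<longrightarrow>
      (\<exists>k. \<exists>m. \<forall>n\<ge>m. real n / real (Suc k) \<le> visits T (ball c (1 / real (Suc j))) n x)"
    show "x \<in> FRec T"
      unfolding FRec_def
    proof (intro CollectI allI impI)
      fix U assume "x \<in> interior U"
      then obtain c j where c: "c \<in> D" "x \<in> ball c (1 / real (Suc j))"
        and sub: "cball c (1 / real (Suc j)) \<subseteq> interior U"
        using ex_small_ball_from_dense[OF D(2) open_interior] by blast
      have "ball c (1 / real (Suc j)) \<subseteq> U"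
        using ball_subset_cball sub interior_subset by (rule subset_trans[OF subset_trans])
      moreover have "0 < lower_density (return_set T x (ball c (1 / real (Suc j))))"
        using *[rule_format, OF c] by (elim exE) (rule lower_density_pos)
      ultimately show "0 < lower_density (return_set T x U)"
        using lower_density_mono[OF return_set_mono] less_le_trans by metis
    qed
  qed
qed

section \<open>Charges and their extension to measures\<close>

text \<open>All subsets have a value, so that limits of empirical frequencies along an orbit are charges without any
question of measurability. Countable additivity is regained later, on a suitable algebra.\<close>

locale charge =
  fixes lam :: "'a set \<Rightarrow> real"
  assumes nonneg: "0 \<le> lam A"
    and disjoint_Un: "A \<inter> B = {} \<Longrightarrow> lam (A \<union> B) = lam A + lam B"
begin

lemma empty [simp]: "lam {} = 0"
  using disjoint_Un[of "{}" "{}"] by simp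

lemma split_Diff: "lam A = lam (A \<inter> B) + lam (A - B)"
  using disjoint_Un[of "A \<inter> B" "A - B"] by (simp add: Int_Diff_Un Int_Diff_disjoint)

lemma mono: "A \<subseteq> B \<Longrightarrow> lam A \<le> lam B"
  using split_Diff[of B A] nonneg[of "B - A"] by (simp add: Int_absorb1)

lemma compl: "lam (- A) = lam UNIV - lam A"
  using split_Diff[of UNIV A] by (simp add: Compl_eq_Diff_UNIV)

lemma subadditive: "lam (A \<union> B) \<le> lam A + lam B"
proof -
  have "lam (A \<union> B) = lam A + lam (B - A)"
    using disjoint_Un[of A "B - A"] by simp
  with mono[of "B - A" B] show ?thesis by auto
qed

lemma finite_subadditive: "finite I \<Longrightarrow> lam (\<Union>i\<in>I. A i) \<le> (\<Sum>i\<in>I. lam (A i))"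
proof (induction I rule: finite_induct)
  case (insert i I)
  then show ?case using subadditive[of "A i" "\<Union>i\<in>I. A i"] by auto
qed auto

text \<open>Inner regularity with respect to the closed sets of a topology \<open>W\<close>, which will be a weak topology with
compact norm balls.\<close>

definition inner_approx :: "'a topology \<Rightarrow> 'a set \<Rightarrow> bool" where
  "inner_approx W A \<longleftrightarrow> (\<forall>\<epsilon>>0. \<exists>C. closedin W C \<and> C \<subseteq> A \<and> lam (A - C) < \<epsilon>)"

lemma inner_approx_closedin: "closedin W C \<Longrightarrow> inner_approx W C"
  unfolding inner_approx_def using subset_refl by fastforce

lemma inner_approx_Int:
  assumes "inner_approx W A" "inner_approx W B"
  shows "inner_approx W (A \<inter> B)"
  unfolding inner_approx_def
proof (intro allI impI)
  fix \<epsilon> :: real assume "\<epsilon> > 0"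
  then have e: "\<epsilon>/2 > 0" by simp
  obtain C where C: "closedin W C" "C \<subseteq> A" "lam (A - C) < \<epsilon>/2"
    using assms(1) e unfolding inner_approx_def by blast
  obtain D where D: "closedin W D" "D \<subseteq> B" "lam (B - D) < \<epsilon>/2"
    using assms(2) e unfolding inner_approx_def by blast
  have "lam (A \<inter> B - C \<inter> D) \<le> lam ((A - C) \<union> (B - D))" by (rule mono) auto
  also have "\<dots> < \<epsilon>" using subadditive[of "A - C" "B - D"] C(3) D(3) by linarith
  finally show "\<exists>E. closedin W E \<and> E \<subseteq> A \<inter> B \<and> lam (A \<inter> B - E) < \<epsilon>"
    using C D by (intro exI[of _ "C \<inter> D"]) auto
qed

lemma inner_approx_Un:
  assumes "inner_approx W A" "inner_approx W B"
  shows "inner_approx W (A \<union> B)"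
  unfolding inner_approx_def
proof (intro allI impI)
  fix \<epsilon> :: real assume "\<epsilon> > 0"
  then have e: "\<epsilon>/2 > 0" by simp
  obtain C where C: "closedin W C" "C \<subseteq> A" "lam (A - C) < \<epsilon>/2"
    using assms(1) e unfolding inner_approx_def by blast
  obtain D where D: "closedin W D" "D \<subseteq> B" "lam (B - D) < \<epsilon>/2"
    using assms(2) e unfolding inner_approx_def by blast
  have "lam ((A \<union> B) - (C \<union> D)) \<le> lam ((A - C) \<union> (B - D))" by (rule mono) auto
  also have "\<dots> < \<epsilon>" using subadditive[of "A - C" "B - D"] C(3) D(3) by linarith
  finally show "\<exists>E. closedin W E \<and> E \<subseteq> A \<union> B \<and> lam (A \<union> B - E) < \<epsilon>"
    using C D by (intro exI[of _ "C \<union> D"]) auto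
qed

text \<open>The analogue of Jordan measurable sets: they and their complements are inner regular. This is an
algebra on which a tight charge is countably additive. Its members need not be Borel sets.\<close>

definition jordan :: "'a topology \<Rightarrow> 'a set set" where
  "jordan W = {A. inner_approx W A \<and> inner_approx W (- A)}"

lemma algebra_jordan:
  assumes "topspace W = UNIV"
  shows "algebra UNIV (jordan W)"
proof -
  have top: "inner_approx W UNIV" using inner_approx_closedin[of W UNIV] assms closedin_topspace[of W] by simp
  have bot: "inner_approx W {}" by (rule inner_approx_closedin) simp
  have 1: "- A \<in> jordan W" if "A \<in> jordan W" for A using that by (auto simp: jordan_def)
  have 2: "A \<inter> B \<in> jordan W" if "A \<in> jordan W" "B \<in> jordan W" for A B
    using that inner_approx_Int inner_approx_Un by (auto simp: jordan_def)
  show ?thesis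
    unfolding algebra_iff_Int using 1 2 top bot by (auto simp: jordan_def Compl_eq_Diff_UNIV[symmetric])
qed

text \<open>A sublevel set of a continuous function is closed; its complement is exhausted by the closed sets
\<open>{x. q + d \<le> g x}\<close>, and what they miss has small charge when the distribution function of \<open>g\<close>
is continuous at \<open>q\<close>. A monotone function has only countably many discontinuities, so such levels
are dense.\<close>

lemma jordan_halfspace:
  assumes W: "topspace W = UNIV" and g: "continuous_map W euclideanreal g"
    and F: "isCont (\<lambda>q. lam {x. g x \<le> q}) q"
  shows "{x. g x \<le> q} \<in> jordan W"
proof -
  have cl: "closedin W {x. g x \<le> q}"
    using closedin_continuous_map_preimage[OF g, of "{..q}"] W by simp
  have "inner_approx W (- {x. g x \<le> q})"
    unfolding inner_approx_def
  proof (intro allI impI)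
    fix \<epsilon> :: real assume "\<epsilon> > 0"
    then obtain d where d: "d > 0" 
      "\<And>y. dist y q < d \<Longrightarrow> dist (lam {x. g x \<le> y}) (lam {x. g x \<le> q}) < \<epsilon>"
      using F unfolding continuous_at_eps_delta by metis
    let ?q = "q + d/2"
    have "dist (lam {x. g x \<le> ?q}) (lam {x. g x \<le> q}) < \<epsilon>" using d by (auto simp: dist_real_def)
    then have *: "lam {x. g x \<le> ?q} - lam {x. g x \<le> q} < \<epsilon>" by (simp add: dist_real_def)
    have "closedin W {x. ?q \<le> g x}"
      using closedin_continuous_map_preimage[OF g, of "{?q..}"] W by simp
    moreover have "{x. ?q \<le> g x} \<subseteq> - {x. g x \<le> q}" using d(1) by auto
    moreover have "lam (- {x. g x \<le> q} - {x. ?q \<le> g x}) \<le> lam ({x. g x \<le> ?q} - {x. g x \<le> q})"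
      by (rule mono) auto
    moreover have "lam {x. g x \<le> ?q} = lam {x. g x \<le> q} + lam ({x. g x \<le> ?q} - {x. g x \<le> q})"
    proof -
      have "{x. g x \<le> ?q} \<inter> {x. g x \<le> q} = {x. g x \<le> q}" using d(1) by auto
      then show ?thesis using split_Diff[of "{x. g x \<le> ?q}" "{x. g x \<le> q}"] by simp
    qed
    ultimately show "\<exists>C. closedin W C \<and> C \<subseteq> - {x. g x \<le> q} \<and> lam (- {x. g x \<le> q} - C) < \<epsilon>"
      using * by (intro exI[of _ "{x. ?q \<le> g x}"]) linarith
  qed
  then show ?thesis using inner_approx_closedin[OF cl] by (simp add: jordan_def)
qed

lemma ex_jordan_halfspace:
  assumes W: "topspace W = UNIV" and g: "continuous_map W euclideanreal g" and "a < b"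
  shows "\<exists>q. a < q \<and> q < b \<and> {x. g x \<le> q} \<in> jordan W"
proof -
  have "mono (\<lambda>q. lam {x. g x \<le> q})" 
    by (intro monoI mono) auto
  from open_minus_countable[OF mono_ctble_discont[OF this], of "{a<..<b}"] \<open>a < b\<close>
  obtain q where "q \<in> {a<..<b}" "isCont (\<lambda>q. lam {x. g x \<le> q}) q" by auto
  with jordan_halfspace[OF W g] show ?thesis by auto
qed

text \<open>The algebra is invariant under the dynamics. This is what makes the extended measure invariant, and
here continuity of \<open>T\<close> for the weak topology enters.\<close>

lemma jordan_vimage:
  assumes W: "topspace W = UNIV" and T: "continuous_map W W T" and inv: "\<And>A. lam (T -` A) = lam A"
    and A: "A \<in> jordan W"
  shows "T -` A \<in> jordan W"
proof -
  have *: "inner_approx W (T -` B)" if "inner_approx W B" for B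
    unfolding inner_approx_def
  proof (intro allI impI)
    fix \<epsilon> :: real assume "\<epsilon> > 0"
    then obtain C where C: "closedin W C" "C \<subseteq> B" "lam (B - C) < \<epsilon>"
      using \<open>inner_approx W B\<close> unfolding inner_approx_def by blast
    have "closedin W (T -` C)"
      using closedin_continuous_map_preimage[OF T C(1)] W by (simp add: vimage_def)
    moreover have "lam (T -` B - T -` C) < \<epsilon>" using inv[of "B - C"] C(3) by (simp add: vimage_Diff)
    ultimately show "\<exists>C. closedin W C \<and> C \<subseteq> T -` B \<and> lam (T -` B - C) < \<epsilon>"
      using C(2) by (intro exI[of _ "T -` C"]) auto
  qed
  show ?thesis using A *[of A] *[of "- A"] by (simp add: jordan_def vimage_Compl)
qed

text \<open>Continuity at the empty set, which is the hypothesis of Caratheodory's theorem. Inside a compact set of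
almost full charge, replace the sets \<open>A i\<close> by closed subsets \<open>C i\<close> with errors that sum to at most
\<open>\<epsilon> / 2\<close>. The intersection of the \<open>C i\<close> is empty, so finitely many of them already have empty
intersection in the compact set, and \<open>A m\<close> is covered by the errors from then on.\<close>

lemma jordan_continuous_at_empty:
  assumes tight: "\<And>\<epsilon>. \<epsilon> > 0 \<Longrightarrow> \<exists>K. compactin W K \<and> lam (- K) < \<epsilon>"
    and A: "range A \<subseteq> jordan W" "decseq A" "(\<Inter>i. A i) = {}"
  shows "(\<lambda>i. lam (A i)) \<longlonglongrightarrow> 0"
proof (rule LIMSEQ_I)
  fix \<epsilon> :: real assume "\<epsilon> > 0"
  obtain K where K: "compactin W K" "lam (- K) < \<epsilon>/2" using tight[of "\<epsilon>/2"] \<open>\<epsilon> > 0\<close> by auto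
  have "\<exists>C. closedin W C \<and> C \<subseteq> A i \<and> lam (A i - C) < \<epsilon>/2 * (1/2)^Suc i" for i :: nat
  proof -
    have "inner_approx W (A i)" using A(1) by (auto simp: jordan_def)
    moreover have "\<epsilon>/2 * (1/2)^Suc i > 0" using \<open>\<epsilon> > 0\<close> by simp
    ultimately show ?thesis unfolding inner_approx_def by blast
  qed
  then have "\<exists>C. \<forall>i. closedin W (C i) \<and> C i \<subseteq> A i \<and> lam (A i - C i) < \<epsilon>/2 * (1/2)^Suc i"
    by (intro choice allI)
  then obtain C where C': "\<forall>i. closedin W (C i) \<and> C i \<subseteq> A i \<and> lam (A i - C i) < \<epsilon>/2 * (1/2)^Suc i"
    by (rule exE)
  have C: "closedin W (C i)" "C i \<subseteq> A i" "lam (A i - C i) < \<epsilon>/2 * (1/2)^Suc i" for i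
    using spec[OF C', of i] by simp_all
  have "(\<Inter>i. C i) \<subseteq> (\<Inter>i. A i)" by (rule INF_mono) (use C(2) in blast)
  then have "K \<inter> \<Inter>(range C) = {}" unfolding A(3) by simp
  then obtain \<F> where F: "finite \<F>" "\<F> \<subseteq> range C" "K \<inter> \<Inter>\<F> = {}"
  proof -
    have "\<And>E. E \<in> range C \<Longrightarrow> closedin W E" using C(1) by auto
    then show thesis using that K(1) \<open>K \<inter> \<Inter>(range C) = {}\<close> unfolding compactin_fip by blast
  qed
  obtain I where I: "finite I" "\<F> = C ` I" using finite_subset_image[OF F(1,2)] by (elim exE conjE)
  obtain n where n: "\<And>i. i \<in> I \<Longrightarrow> i \<le> n" 
    using I(1)[unfolded finite_nat_set_iff_bounded_le] by blast
  have "lam (A m) < \<epsilon>" if "m \<ge> n" for m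
  proof -
    have "A m \<subseteq> - K \<union> (\<Union>i\<in>{..n}. A i - C i)"
    proof
      fix x assume x: "x \<in> A m"
      show "x \<in> - K \<union> (\<Union>i\<in>{..n}. A i - C i)"
      proof (cases "x \<in> K")
        case True
        then obtain i where i: "i \<in> I" "x \<notin> C i" using F(3) I(2) by blast
        then have "x \<in> A i" using decseqD[OF A(2), of i m] n[of i] that x by auto
        then show ?thesis using i n by auto
      qed auto
    qed
    then have "lam (A m) \<le> lam (- K) + lam (\<Union>i\<in>{..n}. A i - C i)"
      using mono subadditive order_trans by blast
    also have "\<dots> \<le> lam (- K) + (\<Sum>i\<in>{..n}. lam (A i - C i))"
      using finite_subadditive[of "{..n}"] by simp
    also have "\<dots> \<le> lam (- K) + (\<Sum>i\<in>{..n}. \<epsilon>/2 * (1/2)^Suc i)"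
      using C(3) by (intro add_left_mono sum_mono) (simp add: less_imp_le)
    also have "(\<Sum>i\<in>{..n}. \<epsilon>/2 * (1/2)^Suc i) = \<epsilon>/2 * (\<Sum>i\<in>{..n}. (1/2)^Suc i)"
      by (simp add: sum_distrib_left)
    also have "(\<Sum>i\<in>{..n}. (1/2)^Suc i) = 1 - (1/2::real)^Suc n"
      by (induction n) (auto simp: field_simps)
    also have "lam (- K) + \<epsilon>/2 * (1 - (1/2)^Suc n) < \<epsilon>"
    proof -
      have "\<epsilon>/2 * (1 - (1/2)^Suc n) \<le> \<epsilon>/2" using \<open>\<epsilon> > 0\<close> by (simp add: field_simps)
      then show ?thesis using K(2) by linarith
    qed
    finally show ?thesis .
  qed
  then show "\<exists>no. \<forall>n\<ge>no. norm (lam (A n) - 0) < \<epsilon>" using nonneg by auto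
qed

end

lemma borel_eq_sigma_cball:
  assumes D: "countable D" "closure D = (UNIV :: 'x::metric_space set)"
  shows "sets (borel :: 'x measure) = sigma_sets UNIV (range (\<lambda>(c, r). cball c r))"
proof -
  have "(borel :: 'x measure) = sigma UNIV (range (\<lambda>(c, r). cball c r))"
    unfolding borel_def
  proof (rule sigma_eqI)
    show "sigma_sets UNIV (Collect open) = sigma_sets UNIV (range (\<lambda>(c::'x, r). cball c r))"
    proof (rule sigma_sets_eqI)
      fix U :: "'x set" assume "U \<in> Collect open"
      then have U: "open U" by simp
      let ?I = "{(c, k). c \<in> D \<and> cball c (1 / real (Suc k)) \<subseteq> U}"
      have "U = (\<Union>(c, k)\<in>?I. cball c (1 / real (Suc k)))"
      proof safe
        fix x assume "x \<in> U"
        then obtain c k where "c \<in> D" "x \<in> ball c (1 / real (Suc k))" "cball c (1 / real (Suc k)) \<subseteq> U"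
          using ex_small_ball_from_dense[OF D(2) U] by blast
        then show "x \<in> (\<Union>(c, k)\<in>?I. cball c (1 / real (Suc k)))"
          by (intro UN_I[of "(c, k)"]) auto
      qed auto
      moreover have "countable ?I"
        by (rule countable_subset[of _ "D \<times> UNIV"]) (auto simp: D(1))
      then have "(\<Union>(c, k)\<in>?I. cball c (1 / real (Suc k))) \<in> sigma_sets UNIV (range (\<lambda>(c::'x, r). cball c r))"
        by (intro sigma_sets_UNION countable_image) (auto intro!: sigma_sets.Basic)
      ultimately show "U \<in> sigma_sets UNIV (range (\<lambda>(c::'x, r). cball c r))" by simp
    next
      fix B :: "'x set" assume "B \<in> range (\<lambda>(c, r). cball c r)"
      then have "closed B" by auto
      then have "UNIV - B \<in> sigma_sets UNIV (Collect open)" by (auto simp: closed_def Compl_eq_Diff_UNIV)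
      then have "UNIV - (UNIV - B) \<in> sigma_sets UNIV (Collect open)" by (rule sigma_sets.Compl)
      then show "B \<in> sigma_sets UNIV (Collect open)" by (simp add: Diff_Diff_Int)
    qed
  qed auto
  then have "sets (borel :: 'x measure) = sets (sigma UNIV (range (\<lambda>(c, r). cball c r)))" by simp
  also have "\<dots> = sigma_sets UNIV (range (\<lambda>(c, r). cball c r))" by (rule sets_measure_of) simp
  finally show ?thesis .
qed

text \<open>The right-hand side is a closed ball with centre \<open>c\<close> when \<open>G\<close> consists of real parts of functionals that
norm the space. The ball itself may fail to be in the algebra, but every half-space that contains it
can be enlarged slightly to a half-space at a good level.\<close>

lemma (in charge) cball_eq_Inter_jordan:
  fixes c :: 'a and G :: "('a \<Rightarrow> real) set"
  assumes W: "topspace W = UNIV"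
    and G: "countable G" "\<And>g. g \<in> G \<Longrightarrow> continuous_map W euclideanreal g"
  shows "\<exists>A. range A \<subseteq> jordan W \<and> (\<Inter>n::nat. A n) = {x. \<forall>g\<in>G. g x - g c \<le> r}"
proof (cases "G = {}")
  case True
  have "UNIV \<in> jordan W" using algebra_jordan[OF W] by (simp add: algebra.top)
  then show ?thesis using True by (intro exI[of _ "\<lambda>_. UNIV"]) auto
next
  case False
  have "\<exists>q. g \<in> G \<longrightarrow> g c + r < q \<and> q < g c + r + 1 / real (Suc n) \<and> {x. g x \<le> q} \<in> jordan W"
    for g and n :: nat
    using ex_jordan_halfspace[OF W G(2), of g "g c + r" "g c + r + 1 / real (Suc n)"] by auto
  then have "\<exists>q. \<forall>g n. g \<in> G \<longrightarrow>
      g c + r < q g n \<and> q g n < g c + r + 1 / real (Suc n) \<and> {x. g x \<le> q g n} \<in> jordan W"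
    by (intro choice allI)
  then obtain q where q': "\<forall>g n. g \<in> G \<longrightarrow>
      g c + r < q g n \<and> q g n < g c + r + 1 / real (Suc n) \<and> {x. g x \<le> q g n} \<in> jordan W"
    by (rule exE)
  have q: "g c + r < q g n" "q g n < g c + r + 1 / real (Suc n)" "{x. g x \<le> q g n} \<in> jordan W"
    if "g \<in> G" for g n
    using that q'[rule_format, of g n] by simp_all
  \<comment> \<open>One sequence runs through all pairs of a function in \<open>G\<close> and an index of its level.\<close>
  define A where "A m = (case prod_decode m of (i, n) \<Rightarrow> {x. from_nat_into G i x \<le> q (from_nat_into G i) n})"
    for m
  have "range A \<subseteq> jordan W"
    using q(3) from_nat_into[OF False] by (auto simp: A_def split: prod.split)
  moreover have "(\<Inter>n::nat. A n) = {x. \<forall>g\<in>G. g x - g c \<le> r}"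
  proof safe
    fix x g assume x: "x \<in> (\<Inter>n. A n)" and g: "g \<in> G"
    have "g x < g c + r + 1 / real (Suc n)" for n
    proof -
      have "x \<in> A (prod_encode (to_nat_on G g, n))" using x by blast
      then have "g x \<le> q g n" using g G(1) by (simp add: A_def)
      with q(2)[OF g, of n] show ?thesis by linarith
    qed
    note bound = this
    show "g x - g c \<le> r"
    proof (rule ccontr)
      assume "\<not> ?thesis"
      then obtain n where "1 / real (Suc n) < g x - g c - r"
        using nat_approx_posE[of "g x - g c - r"] by auto
      with bound[of n] show False by linarith
    qed
  next
    fix x n assume x: "\<forall>g\<in>G. g x - g c \<le> r"
    obtain i k where ik: "prod_decode n = (i, k)" by fastforce
    let ?g = "from_nat_into G i"
    have "?g \<in> G" using False by (rule from_nat_into)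
    then show "x \<in> A n" using x q(1)[of ?g k] ik by (force simp: A_def)
  qed
  ultimately show ?thesis by blast
qed

text \<open>Caratheodory's theorem extends the charge from the algebra \<open>jordan W\<close>. The generated sigma-algebra
contains the closed balls, hence by separability all norm-Borel sets. Invariance passes from the
algebra to the extension, and the inequality for balls holds because a ball is a decreasing limit
of members of the algebra, each of at least its charge.\<close>

theorem invariant_probability_of_charge:
  fixes T :: "'x::metric_space \<Rightarrow> 'x" and W :: "'x topology" and G :: "('x \<Rightarrow> real) set"
  assumes lam: "charge lam" "lam UNIV = 1" and inv: "\<And>A. lam (T -` A) = lam A"
    and tight: "\<And>\<epsilon>. \<epsilon> > 0 \<Longrightarrow> \<exists>K. compactin W K \<and> lam (- K) < \<epsilon>"
    and W: "topspace W = UNIV" and TW: "continuous_map W W T"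
    and G: "countable G" "\<And>g. g \<in> G \<Longrightarrow> continuous_map W euclideanreal g"
    and norming: "\<And>c r. cball c r = {x. \<forall>g\<in>G. g x - g c \<le> r}"
    and D: "countable D" "closure D = (UNIV :: 'x set)"
    and T: "continuous_on UNIV T"
  shows "\<exists>\<mu>. invariant_probability T \<mu> \<and> (\<forall>c r. lam (cball c r) \<le> measure \<mu> (cball c r))"
proof -
  interpret charge lam by fact
  interpret algebra UNIV "jordan W" by (rule algebra_jordan[OF W])
  have cont: "(\<lambda>i. ennreal (lam (A i))) \<longlonglongrightarrow> 0"
    if "range A \<subseteq> jordan W" "decseq A" "(\<Inter>i. A i) = {}" for A
    using tendsto_ennrealI[OF jordan_continuous_at_empty[OF tight that]] by simp
  have "\<exists>m. (\<forall>s\<in>jordan W. m s = ennreal (lam s)) \<and> measure_space UNIV (sigma_sets UNIV (jordan W)) m"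
    by (rule caratheodory_empty_continuous)
       (auto simp: positive_def additive_def disjoint_Un nonneg ennreal_plus[symmetric] cont
             simp del: ennreal_plus)
  then obtain m where m: "\<And>s. s \<in> jordan W \<Longrightarrow> m s = ennreal (lam s)"
    and ms: "measure_space UNIV (sigma_sets UNIV (jordan W)) m" by blast
  define M where "M = measure_of UNIV (jordan W) m"
  have setsM: "sets M = sigma_sets UNIV (jordan W)" and spaceM [simp]: "space M = UNIV"
    by (auto simp: M_def)
  have J: "jordan W \<subseteq> sets M" unfolding setsM by auto
  have emM: "emeasure M A = ennreal (lam A)" if "A \<in> jordan W" for A
  proof -
    have "emeasure M A = m A"
      unfolding M_def
    proof (rule emeasure_measure_of[OF refl])
      show "positive (sets (measure_of UNIV (jordan W) m)) m"
        "countably_additive (sets (measure_of UNIV (jordan W) m)) m"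
        using ms by (simp_all add: measure_space_def)
    qed (use that in auto)
    then show ?thesis using m that by simp
  qed
  have prob: "prob_space M" using emM[OF top] lam(2) by (intro prob_spaceI) simp
  interpret M: prob_space M by fact
  have measM: "measure M A = lam A" if "A \<in> jordan W" for A
    using emM[OF that] nonneg by (simp add: measure_def)
  have meas: "T \<in> measurable M M"
    unfolding setsM[symmetric] by (rule measurable_sigma_sets[of _ UNIV "jordan W"])
      (use setsM jordan_vimage[OF W TW inv] J in auto)
  have distr: "distr M M T = M"
  proof (rule measure_eqI_generator_eq[of "jordan W" UNIV _ _ "\<lambda>_. UNIV"])
    show "Int_stable (jordan W)" by (auto simp: Int_stable_def)
    show "emeasure (distr M M T) X = emeasure M X" if "X \<in> jordan W" for X
      using that emeasure_distr[OF meas, of X] J jordan_vimage[OF W TW inv that]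
      by (auto simp: emM inv)
    show "emeasure (distr M M T) UNIV \<noteq> \<infinity>" for i :: nat
      using emeasure_distr[OF meas, of UNIV] M.emeasure_space_1 J top by auto
  qed (auto simp: setsM)
  have ball: "cball c r \<in> sets M \<and> lam (cball c r) \<le> measure M (cball c r)" for c r
  proof -
    obtain A where A: "range A \<subseteq> jordan W" "(\<Inter>n::nat. A n) = cball c r"
      using cball_eq_Inter_jordan[OF W G, where c=c and r=r] norming by auto
    define B where "B n = (\<Inter>i\<in>{..n}. A i)" for n
    have B: "B n \<in> jordan W" for n
      unfolding B_def using A(1) by (intro finite_INT) auto
    have eq: "(\<Inter>n. B n) = cball c r" unfolding A(2)[symmetric] B_def by auto
    have "decseq B" unfolding decseq_def B_def by (auto intro: order_trans)
    with B J have "(\<lambda>n. measure M (B n)) \<longlonglongrightarrow> measure M (cball c r)"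
      unfolding eq[symmetric] by (intro M.finite_Lim_measure_decseq) auto
    moreover have "lam (cball c r) \<le> measure M (B n)" for n
      unfolding measM[OF B] by (rule mono) (use eq in auto)
    ultimately have "lam (cball c r) \<le> measure M (cball c r)" by (simp add: LIMSEQ_le_const)
    moreover have "cball c r \<in> sets M"
      unfolding A(2)[symmetric] using A(1) J by (intro sets.countable_INT) auto
    ultimately show ?thesis by blast
  qed
  have borel: "sets borel \<subseteq> sets M"
    unfolding borel_eq_sigma_cball[OF D] using ball
    by (intro sets.sigma_sets_subset[of _ M, simplified]) auto
  \<comment> \<open>The sigma-algebra of \<open>M\<close> may be strictly larger than the Borel sigma-algebra.\<close>
  define \<mu> where "\<mu> = restr_to_subalg M borel"
  have sub: "subalgebra M borel" using borel by (auto simp: subalgebra_def)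
  have em: "emeasure \<mu> A = emeasure M A" if "A \<in> sets borel" for A
    unfolding \<mu>_def using emeasure_restr_to_subalg[OF sub that] .
  have "invariant_probability T \<mu>"
    unfolding invariant_probability_def
  proof (intro conjI ballI)
    show "sets \<mu> = sets borel" by (simp add: \<mu>_def sets_restr_to_subalg[OF sub])
    have "space \<mu> = UNIV" by (simp add: \<mu>_def space_restr_to_subalg)
    then show "prob_space \<mu>" using em[of UNIV] M.emeasure_space_1 by (intro prob_spaceI) simp
    fix A :: "'x set" assume A: "A \<in> sets borel"
    then have TA: "T -` A \<in> sets borel"
      using measurable_sets[OF borel_measurable_continuous_onI[OF T] A] by simp
    have "emeasure M (T -` A) = emeasure (distr M M T) A"
      using emeasure_distr[OF meas, of A] A borel by auto
    then show "emeasure \<mu> (T -` A) = emeasure \<mu> A" using em A TA distr by simp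
  qed
  moreover have "measure \<mu> (cball c r) = measure M (cball c r)" for c r
    using em[of "cball c r"] by (simp add: measure_def)
  ultimately show ?thesis using ball by auto
qed

section \<open>Charges carried by recurrent orbits\<close>

text \<open>Tychonoff's theorem for the topology of pointwise convergence.\<close>

lemma compact_coordinatewise:
  fixes S :: "'i \<Rightarrow> 'a::topological_space set"
  assumes "\<And>i. compact (S i)"
  shows "compact {f. \<forall>i. f i \<in> S i}"
proof -
  have "compactin (product_topology (\<lambda>_. euclidean) UNIV) (PiE UNIV S)"
    unfolding compactin_PiE using assms by simp
  moreover have "PiE UNIV S = {f. \<forall>i. f i \<in> S i}" by (auto simp: PiE_def)
  ultimately show ?thesis by (simp add: euclidean_product_topology)
qed

text \<open>A bounded sequence of functions has a pointwise cluster point by Tychonoff's theorem; the filter \<open>L\<close>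
plays the role of a subnet along which it converges. The index type will be a type of sets, so a pointwise
convergent subsequence need not exist.\<close>

lemma coordinatewise_cluster_filter:
  fixes f :: "nat \<Rightarrow> 's \<Rightarrow> real"
  assumes f: "\<And>j s. f j s \<in> {a..b}"
  shows "\<exists>l L. L \<noteq> bot \<and> L \<le> sequentially \<and> (\<forall>s. ((\<lambda>j. f j s) \<longlongrightarrow> l s) L)"
proof -
  have "compact {g :: 's \<Rightarrow> real. \<forall>s. g s \<in> {a..b}}" by (rule compact_coordinatewise) simp
  moreover have "filtermap f sequentially \<noteq> bot" by (simp add: filtermap_bot_iff)
  moreover have "\<forall>\<^sub>F g in filtermap f sequentially. g \<in> {g. \<forall>s. g s \<in> {a..b}}"
    using f by (simp add: eventually_filtermap)
  ultimately obtain l where l: "inf (nhds l) (filtermap f sequentially) \<noteq> bot"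
    unfolding compact_filter by blast
  define L where "L = inf sequentially (filtercomap f (nhds l))"
  have "L \<noteq> bot"
  proof
    assume "L = bot"
    then have "eventually (\<lambda>_. False) L" by simp
    then obtain P Q where P: "eventually P sequentially" and Q: "eventually Q (filtercomap f (nhds l))"
      and PQ: "\<And>j. P j \<Longrightarrow> Q j \<Longrightarrow> False"
      unfolding L_def eventually_inf by blast
    obtain R where R: "eventually R (nhds l)" "\<And>j. R (f j) \<Longrightarrow> Q j"
      using Q unfolding eventually_filtercomap by blast
    have "eventually (\<lambda>g. \<not> R g) (filtermap f sequentially)"
      unfolding eventually_filtermap using P by eventually_elim (use PQ R(2) in blast)
    then have "eventually (\<lambda>_. False) (inf (nhds l) (filtermap f sequentially))"
      using R(1) unfolding eventually_inf by (intro exI[of _ R] exI[of _ "\<lambda>g. \<not> R g"]) auto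
    with l show False by simp
  qed
  moreover have "L \<le> sequentially" by (simp add: L_def)
  moreover have "((\<lambda>j. f j s) \<longlongrightarrow> l s) L" for s
  proof (rule topological_tendstoI)
    fix U assume U: "open U" "l s \<in> U"
    have "filterlim f (nhds l) L"
      unfolding L_def filterlim_def using filtermap_filtercomap[of f "nhds l"]
      by (meson filtermap_mono inf_le2 order_trans)
    moreover have "open ((\<lambda>g. g s) -` U)"
      by (rule open_vimage[OF U(1) continuous_on_product_coordinates])
    then have "\<forall>\<^sub>F g in nhds l. g s \<in> U"
      unfolding eventually_nhds using U(2) by (intro exI[of _ "(\<lambda>g. g s) -` U"]) auto
    ultimately show "\<forall>\<^sub>F j in L. f j s \<in> U" unfolding filterlim_iff by blast
  qed
  ultimately show ?thesis by blast
qed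

lemma upper_Banach_density_windows:
  assumes "0 < upper_Banach_density A"
  shows "\<exists>\<delta>>0. \<forall>n. \<exists>N\<ge>n. \<exists>m. \<delta> \<le> real (card (A \<inter> {m..m + N})) / real (N + 1)"
proof -
  let ?u = "\<lambda>N. SUP m. ereal (real (card (A \<inter> {m..m + N})) / real (N + 1))"
  obtain \<delta> where \<delta>: "0 < ereal \<delta>" "ereal \<delta> < upper_Banach_density A"
    using ereal_dense2[OF assms] by blast
  have "\<exists>N\<ge>n. \<exists>m. \<delta> \<le> real (card (A \<inter> {m..m + N})) / real (N + 1)" for n
  proof (rule ccontr)
    assume "\<not> ?thesis"
    then have *: "\<And>N m. N \<ge> n \<Longrightarrow> real (card (A \<inter> {m..m + N})) / real (N + 1) < \<delta>"
      by (meson not_le)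
    have "upper_Banach_density A \<le> ereal \<delta>"
      unfolding upper_Banach_density_def
    proof (rule Limsup_bounded)
      show "\<forall>\<^sub>F N in sequentially. ?u N \<le> ereal \<delta>"
        using eventually_ge_at_top[of n]
        by eventually_elim (use * in \<open>auto intro!: SUP_least simp: less_imp_le\<close>)
    qed
    with \<delta>(2) show False by simp
  qed
  with \<delta>(1) show ?thesis by auto
qed

text \<open>The charge is a cluster point of the empirical frequencies of the orbit over windows of increasing length
in which \<open>V\<close> is visited with a frequency that stays away from zero. Moving a window by one step
changes at most two of its terms, so the limit is invariant.\<close>

lemma orbit_charge:
  assumes "0 < upper_Banach_density (return_set T x V)"
  shows "\<exists>\<nu>. charge \<nu> \<and> \<nu> UNIV = 1 \<and> (\<forall>A. \<nu> (T -` A) = \<nu> A) \<and> 0 < \<nu> V"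
proof -
  obtain \<delta> where \<delta>: "\<delta> > 0"
    "\<And>n. \<exists>N\<ge>n. \<exists>m. \<delta> \<le> real (card (return_set T x V \<inter> {m..m + N})) / real (N + 1)"
    using upper_Banach_density_windows[OF assms] by blast
  have "\<exists>w. \<forall>n. n \<le> fst (w n) \<and> \<delta> \<le> real (card (return_set T x V \<inter> {snd (w n)..snd (w n) + fst (w n)})) / real (fst (w n) + 1)"
    by (intro choice allI) (use \<delta>(2) in auto)
  then obtain w where w: "\<And>n. n \<le> fst (w n)"
     "\<And>n. \<delta> \<le> real (card (return_set T x V \<inter> {snd (w n)..snd (w n) + fst (w n)})) / real (fst (w n) + 1)"
    by blast
  \<comment> \<open>The window number \<open>j\<close> starts at \<open>m j\<close> and has length \<open>N j + 1\<close>.\<close>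
  define N m where "N = fst \<circ> w" and "m = snd \<circ> w"
  define h :: "'a set \<Rightarrow> nat \<Rightarrow> real" where "h A i = indicator A ((T ^^ i) x)" for A i
  define f where "f j A = (\<Sum>i=m j..m j + N j. h A i) / real (N j + 1)" for j A
  have f01: "f j A \<in> {0..1}" for j A
  proof -
    have "(\<Sum>i=m j..m j + N j. h A i) \<le> (\<Sum>i=m j..m j + N j. 1)"
      by (intro sum_mono) (simp add: h_def indicator_def)
    moreover have "0 \<le> (\<Sum>i=m j..m j + N j. h A i)" by (intro sum_nonneg) (simp add: h_def)
    ultimately show ?thesis by (simp add: f_def)
  qed
  obtain \<nu> L where L: "L \<noteq> bot" "L \<le> sequentially" and lim: "\<And>A. ((\<lambda>j. f j A) \<longlongrightarrow> \<nu> A) L"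
    using coordinatewise_cluster_filter[where f = f, OF f01] by blast
  have "charge \<nu>"
  proof
    show "0 \<le> \<nu> A" for A by (rule tendsto_lowerbound[OF lim _ L(1)]) (use f01 in auto)
    fix A B :: "'a set" assume "A \<inter> B = {}"
    then have "f j (A \<union> B) = f j A + f j B" for j
      by (auto simp: f_def h_def indicator_add[symmetric] sum.distrib add_divide_distrib[symmetric])
    then have "((\<lambda>j. f j A + f j B) \<longlongrightarrow> \<nu> (A \<union> B)) L" using lim[of "A \<union> B"] by simp
    then show "\<nu> (A \<union> B) = \<nu> A + \<nu> B"
      by (rule tendsto_unique[OF L(1)]) (intro tendsto_add lim)
  qed
  moreover have "\<nu> UNIV = 1"
  proof -
    have "f j UNIV = 1" for j by (simp add: f_def h_def)
    then have "((\<lambda>j. 1) \<longlongrightarrow> \<nu> UNIV) L" using lim[of UNIV] by simp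
    then show ?thesis by (rule tendsto_unique[OF L(1) _ tendsto_const])
  qed
  moreover have "\<nu> (T -` A) = \<nu> A" for A
  proof -
    have "norm (f j (T -` A) - f j A) \<le> 1 / real (Suc j)" for j
    proof -
      have "f j (T -` A) - f j A = (\<Sum>i=m j..m j + N j. h A (Suc i) - h A i) / real (N j + 1)"
        by (simp add: f_def h_def indicator_def sum_subtractf diff_divide_distrib)
      also have "\<dots> = (h A (Suc (m j + N j)) - h A (m j)) / real (N j + 1)"
        by (subst sum_Suc_diff) auto
      also have "norm \<dots> \<le> 1 / real (N j + 1)"
        by (auto simp: h_def indicator_def)
      also have "\<dots> \<le> 1 / real (Suc j)" using w(1)[of j] by (simp add: N_def frac_le)
      finally show ?thesis .
    qed
    then have "(\<lambda>j. f j (T -` A) - f j A) \<longlonglongrightarrow> 0"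
      by (intro Lim_null_comparison[OF always_eventually LIMSEQ_inverse_real_of_nat[unfolded inverse_eq_divide]]) auto
    then have "((\<lambda>j. f j (T -` A) - f j A) \<longlongrightarrow> 0) L" using L(2) tendsto_mono by blast
    from tendsto_unique[OF L(1) tendsto_diff[OF lim lim] this] show ?thesis by simp
  qed
  moreover have "\<delta> \<le> \<nu> V"
  proof (rule tendsto_lowerbound[OF lim _ L(1)], intro always_eventually allI)
    fix j
    have "(\<Sum>i=m j..m j + N j. h V i) = real (card (return_set T x V \<inter> {m j..m j + N j}))"
      by (simp add: h_def indicator_def sum.If_cases return_set_def Int_def conj_commute)
    then show "\<delta> \<le> f j V" using w(2)[of j] by (simp add: f_def N_def m_def)
  qed
  ultimately show ?thesis using \<delta>(1) by (intro exI[of _ \<nu>]) auto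
qed

text \<open>The orbit may be unbounded, and then part of the charge escapes to infinity. What remains is
\<open>l A\<close>, the supremum of the charges of the bounded parts of \<open>A\<close>. Mass can only be lost in one
direction, as \<open>T\<close> maps bounded sets to bounded sets: \<open>l (T -` A) \<le> l A\<close>. Applied to the complement of
\<open>A\<close>, the same inequality forces equality, because both sides have the same total mass.\<close>

lemma tight_charge:
  fixes T :: "'x::real_normed_vector \<Rightarrow> 'x"
  assumes "charge \<nu>" and prob: "\<nu> UNIV = 1" and inv: "\<And>A. \<nu> (T -` A) = \<nu> A"
    and T: "\<And>x. norm (T x) \<le> C * norm x" and V: "bounded V" "0 < \<nu> V"
  shows "\<exists>lam. charge lam \<and> lam UNIV = 1 \<and> (\<forall>A. lam (T -` A) = lam A) \<and> 0 < lam V \<and>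
    (\<forall>\<epsilon>>0. \<exists>R. lam (- cball 0 R) < \<epsilon>)"
proof -
  interpret \<nu>: charge \<nu> by fact
  let ?s = "\<lambda>A n. \<nu> (A \<inter> cball 0 (real n))"
  define l where "l A = (SUP n. ?s A n)" for A
  have bdd: "bdd_above (range (?s A))" for A
    by (rule bdd_aboveI2[where M = "\<nu> A"]) (auto intro: \<nu>.mono)
  have le: "?s A n \<le> l A" for A n unfolding l_def by (rule cSUP_upper[OF _ bdd]) simp
  have least: "l A \<le> a" if "\<And>n. ?s A n \<le> a" for A a
    unfolding l_def by (rule cSUP_least) (use that in auto)
  have le_ball: "\<nu> (A \<inter> cball 0 R) \<le> l A" for A R
  proof -
    obtain n :: nat where "R \<le> real n" using real_arch_simple by blast
    then have "\<nu> (A \<inter> cball 0 R) \<le> ?s A n" by (intro \<nu>.mono) auto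
    with le show ?thesis by (rule order_trans[rotated])
  qed
  have lim: "?s A \<longlonglongrightarrow> l A" for A
    unfolding l_def by (intro LIMSEQ_incseq_SUP bdd incseq_SucI \<nu>.mono) auto
  have charge_l: "charge l"
  proof
    show "0 \<le> l A" for A using order_trans[OF \<nu>.nonneg le[of A 0]] .
    fix A B :: "'x set" assume "A \<inter> B = {}"
    then have "?s (A \<union> B) n = ?s A n + ?s B n" for n
      using \<nu>.disjoint_Un[of "A \<inter> cball 0 (real n)" "B \<inter> cball 0 (real n)"]
      by (simp add: Int_Un_distrib2 disjoint_iff)
    then have "(\<lambda>n. ?s A n + ?s B n) \<longlonglongrightarrow> l (A \<union> B)" using lim[of "A \<union> B"] by simp
    then show "l (A \<union> B) = l A + l B" by (rule LIMSEQ_unique) (intro tendsto_add lim)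
  qed
  interpret l: charge l by (rule charge_l)
  have l_le: "l (T -` A) \<le> l A" for A
  proof (rule least)
    fix n
    have "T -` A \<inter> cball 0 (real n) \<subseteq> T -` (A \<inter> cball 0 (\<bar>C\<bar> * real n))"
    proof
      fix x assume x: "x \<in> T -` A \<inter> cball 0 (real n)"
      have "norm (T x) \<le> \<bar>C\<bar> * norm x"
        using T[of x] mult_right_mono[OF abs_ge_self norm_ge_zero, of C x] by linarith
      also have "\<dots> \<le> \<bar>C\<bar> * real n" using x by (intro mult_left_mono) auto
      finally show "x \<in> T -` (A \<inter> cball 0 (\<bar>C\<bar> * real n))" using x by auto
    qed
    then have "?s (T -` A) n \<le> \<nu> (A \<inter> cball 0 (\<bar>C\<bar> * real n))"
      using \<nu>.mono inv by metis
    also have "\<dots> \<le> l A" by (rule le_ball)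
    finally show "?s (T -` A) n \<le> l A" .
  qed
  have l_inv: "l (T -` A) = l A" for A
    using l_le[of A] l_le[of "- A"] unfolding vimage_Compl l.compl by linarith
  obtain R where R: "V \<subseteq> cball 0 R" 
  proof -
    obtain R where "\<forall>x\<in>V. norm x \<le> R" using V(1) unfolding bounded_iff by (elim exE)
    then show thesis by (intro that[of R]) auto
  qed
  have "0 < l V" using V(2) le_ball[of V R] R by (simp add: Int_absorb2)
  then have pos: "0 < l UNIV" using l.mono[of V UNIV] by simp
  define lam where "lam A = l A / l UNIV" for A
  have "charge lam"
    by unfold_locales (use pos l.nonneg l.disjoint_Un in \<open>auto simp: lam_def add_divide_distrib\<close>)
  moreover have "\<exists>R. lam (- cball 0 R) < \<epsilon>" if "\<epsilon> > 0" for \<epsilon>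
  proof -
    have "l UNIV - \<epsilon> * l UNIV < l UNIV" using that pos by simp
    then obtain n where "l UNIV - \<epsilon> * l UNIV < ?s UNIV n"
      using order_tendstoD(1)[OF lim[of UNIV]] eventually_happens[of _ sequentially] by (metis sequentially_bot)
    also have "\<dots> \<le> l (cball 0 (real n))" using le[of "cball 0 (real n)" n] by simp
    finally have "l (- cball 0 (real n)) < \<epsilon> * l UNIV" by (simp add: l.compl)
    then show ?thesis using pos by (intro exI[of _ "real n"]) (simp add: lam_def divide_less_eq)
  qed
  ultimately show ?thesis
    using pos \<open>0 < l V\<close> l_inv by (intro exI[of _ lam]) (auto simp: lam_def)
qed

text \<open>The ball around \<open>x\<close> is bounded, so the charge that the visits of the orbit give to it survives the removal of
the mass at infinity, and the measure gives it at least as much.\<close>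

theorem invariant_probability_of_RRec:
  fixes T :: "'x::real_normed_vector \<Rightarrow> 'x" and W :: "'x topology" and G :: "('x \<Rightarrow> real) set"
  assumes W: "topspace W = UNIV" and TW: "continuous_map W W T"
    and compact: "\<And>R. compactin W (cball 0 R)"
    and G: "countable G" "\<And>g. g \<in> G \<Longrightarrow> continuous_map W euclideanreal g"
    and norming: "\<And>c r. cball c r = {x. \<forall>g\<in>G. g x - g c \<le> r}"
    and D: "countable D" "closure D = (UNIV :: 'x set)"
    and T: "continuous_on UNIV T" "\<And>x. norm (T x) \<le> C * norm x"
    and x: "x \<in> RRec T" and r: "r > 0"
  shows "\<exists>\<mu>. invariant_probability T \<mu> \<and> 0 < measure \<mu> (cball x r)"
proof -
  have "x \<in> interior (cball x r)" using r ball_subset_cball centre_in_ball interior_maximal open_ball by blast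
  then have "0 < upper_Banach_density (return_set T x (cball x r))"
    using x by (simp only: RRec_def mem_Collect_eq)
  then obtain \<nu> where \<nu>: "charge \<nu>" "\<nu> UNIV = 1" "\<And>A. \<nu> (T -` A) = \<nu> A" "0 < \<nu> (cball x r)"
    using orbit_charge by metis
  obtain lam where lam: "charge lam" "lam UNIV = 1" "\<And>A. lam (T -` A) = lam A"
    "0 < lam (cball x r)" "\<And>\<epsilon>. \<epsilon> > 0 \<Longrightarrow> \<exists>R. lam (- cball 0 R) < \<epsilon>"
    using tight_charge[OF \<nu>(1-3) T(2) bounded_cball \<nu>(4)] by blast
  have "\<exists>K. compactin W K \<and> lam (- K) < \<epsilon>" if "\<epsilon> > 0" for \<epsilon>
    using lam(5)[OF that] compact by blast
  from invariant_probability_of_charge[OF lam(1-3) this W TW G norming D T(1)]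
  show ?thesis using lam(4) less_le_trans by blast
qed

section \<open>Norming functionals\<close>

definition sublinear :: "('v::real_vector \<Rightarrow> real) \<Rightarrow> bool" where
  "sublinear q \<longleftrightarrow> (\<forall>x y. q (x + y) \<le> q x + q y) \<and> (\<forall>t\<ge>0. \<forall>x. q (t *\<^sub>R x) \<le> t * q x)"

lemma sublinear_add: "sublinear q \<Longrightarrow> q (x + y) \<le> q x + q y"
  by (simp add: sublinear_def)

lemma sublinear_zero:
  assumes "sublinear q"
  shows "q 0 = 0"
proof -
  have "q (0 *\<^sub>R 0) \<le> 0 * q 0" using assms unfolding sublinear_def by blast
  moreover have "q (0 + 0) \<le> q 0 + q 0" using assms unfolding sublinear_def by blast
  ultimately show ?thesis by simp
qed

lemma sublinear_scaleR:
  assumes "sublinear q" "t \<ge> 0"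
  shows "q (t *\<^sub>R x) = t * q x"
proof (cases "t = 0")
  case True
  then show ?thesis using sublinear_zero[OF assms(1)] by simp
next
  case False
  have *: "q (s *\<^sub>R y) \<le> s * q y" if "s \<ge> 0" for s y
    using assms(1) that unfolding sublinear_def by blast
  have "q ((1/t) *\<^sub>R (t *\<^sub>R x)) \<le> (1/t) * q (t *\<^sub>R x)" "q (t *\<^sub>R x) \<le> t * q x"
    by (rule *; use assms(2) in simp)+
  then show ?thesis using assms(2) False by (simp add: field_simps)
qed

lemma sublinear_ge_uminus: "sublinear q \<Longrightarrow> - q (- x) \<le> q x"
  using sublinear_add[of q x "- x"] sublinear_zero[of q] by simp

text \<open>The sublinear functional below \<open>q\<close> that is obtained by forcing the value at \<open>- x\<close> down to \<open>- q x\<close>. It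
serves twice: a sublinear functional that cannot be lowered in this way at any \<open>x\<close> is linear, and lowering
the norm at \<open>x\<close> yields functionals that attain their norm at \<open>x\<close>.\<close>

definition lowered :: "('v::real_vector \<Rightarrow> real) \<Rightarrow> 'v \<Rightarrow> 'v \<Rightarrow> real" where
  "lowered q x z = (INF t\<in>{0..}. q (z + t *\<^sub>R x) - t * q x)"

lemma lowered_le:
  assumes "sublinear q" "t \<ge> 0"
  shows "lowered q x z \<le> q (z + t *\<^sub>R x) - t * q x"
  unfolding lowered_def
proof (rule cINF_lower)
  show "bdd_below ((\<lambda>t. q (z + t *\<^sub>R x) - t * q x) ` {0..})"
  proof (rule bdd_belowI2)
    fix t :: real assume "t \<in> {0..}"
    then show "- q (- z) \<le> q (z + t *\<^sub>R x) - t * q x"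
      using sublinear_add[OF assms(1), of "z + t *\<^sub>R x" "- z"] sublinear_scaleR[OF assms(1), of t x] by simp
  qed
qed (use assms(2) in simp)

lemma lowered_greatest:
  assumes "\<And>t. t \<ge> 0 \<Longrightarrow> a \<le> q (z + t *\<^sub>R x) - t * q x"
  shows "a \<le> lowered q x z"
  unfolding lowered_def using assms by (intro cINF_greatest) auto

lemma sublinear_lowered:
  assumes q: "sublinear q"
  shows "sublinear (lowered q x)"
  unfolding sublinear_def
proof (intro conjI allI impI)
  fix y z
  have *: "lowered q x (y + z) \<le> (q (y + s *\<^sub>R x) - s * q x) + (q (z + t *\<^sub>R x) - t * q x)"
    if "s \<ge> 0" "t \<ge> 0" for s t
  proof -
    have "lowered q x (y + z) \<le> q ((y + z) + (s + t) *\<^sub>R x) - (s + t) * q x"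
      using that by (intro lowered_le[OF q]) simp
    also have "(y + z) + (s + t) *\<^sub>R x = (y + s *\<^sub>R x) + (z + t *\<^sub>R x)" by (simp add: algebra_simps)
    finally show ?thesis using sublinear_add[OF q, of "y + s *\<^sub>R x" "z + t *\<^sub>R x"] by (simp add: algebra_simps)
  qed
  have "lowered q x (y + z) - (q (z + t *\<^sub>R x) - t * q x) \<le> lowered q x y" if "t \<ge> 0" for t
    using * that by (intro lowered_greatest) (simp add: algebra_simps)
  then have "lowered q x (y + z) - lowered q x y \<le> lowered q x z"
    by (intro lowered_greatest) (simp add: algebra_simps)
  then show "lowered q x (y + z) \<le> lowered q x y + lowered q x z" by simp
next
  fix a :: real and z assume a: "a \<ge> 0"
  show "lowered q x (a *\<^sub>R z) \<le> a * lowered q x z"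
  proof (cases "a = 0")
    case True
    then show ?thesis using lowered_le[OF q, of 0 x 0] sublinear_zero[OF q] by simp
  next
    case False
    have "lowered q x (a *\<^sub>R z) / a \<le> lowered q x z"
    proof (rule lowered_greatest)
      fix t :: real assume t: "t \<ge> 0"
      have "lowered q x (a *\<^sub>R z) \<le> q (a *\<^sub>R z + (a * t) *\<^sub>R x) - (a * t) * q x"
        using a t by (intro lowered_le[OF q]) simp
      also have "q (a *\<^sub>R z + (a * t) *\<^sub>R x) = a * q (z + t *\<^sub>R x)"
        using sublinear_scaleR[OF q a, of "z + t *\<^sub>R x"] by (simp add: scaleR_add_right)
      finally show "lowered q x (a *\<^sub>R z) / a \<le> q (z + t *\<^sub>R x) - t * q x"
        using a False by (simp add: field_simps)
    qed
    then show ?thesis using a False by (simp add: field_simps)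
  qed
qed

text \<open>By minimality \<open>lowered q x = q\<close> for every \<open>x\<close>. The term with \<open>t = 1\<close> of the infimum then gives
\<open>q z + q x \<le> q (z + x)\<close>, the converse of subadditivity.\<close>

lemma minimal_sublinear_linear:
  assumes q: "sublinear q"
    and minimal: "\<And>q'. sublinear q' \<Longrightarrow> (\<And>x. q' x \<le> q x) \<Longrightarrow> q' = q"
  shows "linear q"
proof -
  have "lowered q x = q" for x
    using lowered_le[OF q order_refl, of x] by (intro minimal sublinear_lowered q) simp
  then have "q z \<le> q (z + x) - q x" for x z
    using lowered_le[OF q, of 1 x z] by simp
  then have add: "q (z + x) = q z + q x" for x z
    using sublinear_add[OF q, of z x] by (simp add: algebra_simps order_antisym)
  have minus: "q (- x) = - q x" for x
    using add[of x "- x"] sublinear_zero[OF q] by simp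
  show ?thesis
  proof (rule linearI)
    fix t :: real and x
    show "q (t *\<^sub>R x) = t *\<^sub>R q x"
    proof (cases "t \<ge> 0")
      case False
      then have "q (- ((- t) *\<^sub>R x)) = - ((- t) * q x)"
        using minus[of "(- t) *\<^sub>R x"] sublinear_scaleR[OF q, of "- t" x] by linarith
      then show ?thesis by simp
    qed (simp add: sublinear_scaleR[OF q])
  qed (rule add)
qed

text \<open>The Hahn-Banach theorem in the form that needs no subspaces: Zorn's lemma gives a minimal
sublinear functional below \<open>p\<close>, and minimal ones are linear. The infimum over a chain is finite, as
\<open>- p (- x)\<close> bounds the values at \<open>x\<close> from below.\<close>

theorem linear_below_sublinear:
  assumes p: "sublinear p"
  shows "\<exists>f. linear f \<and> (\<forall>x. f x \<le> p x)"
proof -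
  let ?A = "{q. sublinear q \<and> q \<le> p}"
  have "\<exists>m\<in>?A. \<forall>a\<in>?A. a \<le> m \<longrightarrow> a = m"
  proof (rule predicate_Zorn)
    show "partial_order_on ?A (relation_of (\<lambda>q q'. q' \<le> q) ?A)"
      by (auto simp: relation_of_def partial_order_on_def preorder_on_def refl_on_def trans_def antisym_def)
    fix C assume C: "C \<in> Chains (relation_of (\<lambda>q q'. q' \<le> q) ?A)"
    show "\<exists>u\<in>?A. \<forall>a\<in>C. u \<le> a"
    proof (cases "C = {}")
      case True
      then show ?thesis using p by auto
    next
      case False
      have CA: "sublinear q" "q \<le> p" if "q \<in> C" for q
        using C that by (auto simp: Chains_def relation_of_def)
      have chain: "q \<le> q' \<or> q' \<le> q" if "q \<in> C" "q' \<in> C" for q q'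
        using C that by (auto simp: Chains_def relation_of_def)
      define u where "u x = (INF q\<in>C. q x)" for x
      have u_le: "u x \<le> q x" if "q \<in> C" for q x
        unfolding u_def
      proof (rule cINF_lower[OF bdd_belowI2 that])
        fix q assume "q \<in> C"
        then show "- p (- x) \<le> q x"
          using sublinear_ge_uminus[OF CA(1)] CA(2) by (metis le_fun_def neg_le_iff_le order_trans)
      qed
      have u_ge: "a \<le> u x" if "\<And>q. q \<in> C \<Longrightarrow> a \<le> q x" for a x
        unfolding u_def using False that by (intro cINF_greatest) auto
      have "sublinear u"
        unfolding sublinear_def
      proof (intro conjI allI impI)
        fix x y
        have *: "u (x + y) \<le> q x + q' y" if "q \<in> C" "q' \<in> C" for q q'
          using chain[OF that]
        proof
          assume "q \<le> q'"
          then show ?thesis using u_le[OF that(1), of "x + y"] sublinear_add[OF CA(1)[OF that(1)], of x y]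
            by (auto simp: le_fun_def dest!: spec[of _ y])
        next
          assume "q' \<le> q"
          then show ?thesis using u_le[OF that(2), of "x + y"] sublinear_add[OF CA(1)[OF that(2)], of x y]
            by (auto simp: le_fun_def dest!: spec[of _ x])
        qed
        have "u (x + y) - q' y \<le> u x" if "q' \<in> C" for q'
          using *[OF _ that] by (intro u_ge) (simp add: algebra_simps)
        then have "u (x + y) - u x \<le> u y"
          by (intro u_ge) (simp add: algebra_simps)
        then show "u (x + y) \<le> u x + u y" by simp
      next
        fix t :: real and x assume t: "t \<ge> 0"
        show "u (t *\<^sub>R x) \<le> t * u x"
        proof (cases "t = 0")
          case True
          obtain q where "q \<in> C" using False by blast
          then show ?thesis using u_le[of q 0] sublinear_zero[OF CA(1)[of q]] True by simp
        next
          case False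
          have "u (t *\<^sub>R x) / t \<le> u x"
          proof (rule u_ge)
            fix q assume "q \<in> C"
            then show "u (t *\<^sub>R x) / t \<le> q x"
              using u_le[of q "t *\<^sub>R x"] sublinear_scaleR[OF CA(1) t] t False by (simp add: field_simps)
          qed
          then show ?thesis using t False by (simp add: field_simps)
        qed
      qed
      moreover have "u \<le> p" using False u_le CA(2) by (metis all_not_in_conv le_fun_def order_trans)
      moreover have "\<forall>a\<in>C. u \<le> a" using u_le by (auto simp: le_fun_def)
      ultimately show ?thesis by blast
    qed
  qed
  then obtain f where f: "sublinear f" "f \<le> p" and m: "\<And>a. sublinear a \<Longrightarrow> a \<le> p \<Longrightarrow> a \<le> f \<Longrightarrow> a = f" by auto
  have "linear f"
  proof (rule minimal_sublinear_linear[OF f(1)])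
    fix q' assume "sublinear q'" and "\<And>x. q' x \<le> f x"
    moreover from this(2) have "q' \<le> f" by (simp add: le_fun_def)
    ultimately show "q' = f" using m[of q'] f(2) by (meson order_trans)
  qed
  with f(2) show ?thesis by (auto simp: le_fun_def)
qed

corollary norming_real_functional:
  fixes x :: "'v::real_normed_vector"
  shows "\<exists>f. linear f \<and> (\<forall>z. f z \<le> norm z) \<and> f x = norm x"
proof -
  have n: "sublinear (norm :: 'v \<Rightarrow> real)" by (auto simp: sublinear_def norm_triangle_ineq)
  obtain f where f: "linear f" "\<And>z. f z \<le> lowered norm x z"
    using linear_below_sublinear[OF sublinear_lowered[OF n, of x]] by blast
  have "f z \<le> norm z" for z
    using order_trans[OF f(2) lowered_le[OF n order_refl]] by simp
  moreover have "f x \<ge> norm x"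
    using order_trans[OF f(2)[of "- x"] lowered_le[OF n, of 1 x "- x"]] linear_neg[OF f(1), of x] by simp
  ultimately show ?thesis using f(1) by (metis order_antisym)
qed

text \<open>On the scalar field the real bilinear form \<open>(c * z) \<bullet> 1\<close> is nondegenerate, as one sees by taking
\<open>c = inverse z\<close>; for the complex numbers it is the real part of the product. Hence it represents every
real functional on the scalars. This recovers a scalar-linear functional from its real part
in a way that covers the real and the complex case at once.\<close>

lemma represent_by_mult_inner:
  fixes h :: "'k::{real_normed_field, euclidean_space} \<Rightarrow> real"
  assumes "linear h"
  shows "\<exists>z. \<forall>c. h c = (c * z) \<bullet> 1"
proof -
  define L where "L z = (\<Sum>b\<in>Basis. ((b * z) \<bullet> 1) *\<^sub>R b)" for z :: 'k
  have lin: "linear (\<lambda>c. (c * z) \<bullet> 1)" for z :: 'k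
    by (rule linearI) (auto simp: algebra_simps inner_add_left)
  have L: "L z \<bullet> c = (c * z) \<bullet> 1" for z c
  proof -
    have "(c * z) \<bullet> 1 = ((\<Sum>b\<in>Basis. (c \<bullet> b) *\<^sub>R b) * z) \<bullet> 1"
      by (simp only: euclidean_representation)
    also have "\<dots> = (\<Sum>b\<in>Basis. (c \<bullet> b) * ((b * z) \<bullet> 1))"
      by (simp add: sum_distrib_right inner_sum_left)
    also have "\<dots> = L z \<bullet> c" 
      by (simp add: L_def inner_sum_left mult.commute inner_commute[of c])
    finally show ?thesis by simp
  qed
  have "linear L"
    by (rule linearI) (auto simp: L_def algebra_simps inner_add_left sum.distrib scaleR_sum_right)
  moreover have "inj L"
  proof (subst linear_injective_0[OF \<open>linear L\<close>], intro allI impI, rule ccontr)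
    fix z assume "L z = 0" "z \<noteq> 0"
    then show False using L[of z "inverse z"] by (simp add: dot_square_norm)
  qed
  ultimately have "surj L" by (rule linear_inj_imp_surj)
  then obtain z where z: "L z = (\<Sum>b\<in>Basis. h b *\<^sub>R b)" by (metis surjD)
  have "h c = (c * z) \<bullet> 1" for c
  proof -
    have "h c = h (\<Sum>b\<in>Basis. (c \<bullet> b) *\<^sub>R b)" by (simp only: euclidean_representation)
    also have "\<dots> = (\<Sum>b\<in>Basis. (c \<bullet> b) * h b)"
      by (simp add: linear_sum[OF assms] linear_scale[OF assms])
    also have "\<dots> = L z \<bullet> c" 
      by (simp add: z inner_sum_left mult.commute inner_commute[of c])
    finally show ?thesis using L by simp
  qed
  then show ?thesis by blast
qed

lemma mult_inner_one_eqD: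
  fixes z w :: "'k::{real_normed_field, euclidean_space}"
  assumes "\<And>c. (c * z) \<bullet> 1 = (c * w) \<bullet> 1"
  shows "z = w"
proof (rule ccontr)
  assume "z \<noteq> w"
  then have "(inverse (z - w) * (z - w)) \<bullet> 1 = 1" by (simp add: dot_square_norm)
  then show False using assms[of "inverse (z - w)"] by (simp add: algebra_simps inner_diff_left)
qed

lemma ex_rotation:
  fixes z :: "'k::{real_normed_field, euclidean_space}"
  shows "\<exists>c. norm c = 1 \<and> (c * z) \<bullet> 1 = norm z"
proof (cases "z = 0")
  case False
  then have "(of_real (norm z) / z) * z = norm z *\<^sub>R 1"
    by (simp only: nonzero_mult_div_cancel_right times_divide_eq_left scaleR_conv_of_real) simp
  then have "((of_real (norm z) / z) * z) \<bullet> 1 = norm z" by (simp add: dot_square_norm)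
  then show ?thesis using False by (intro exI[of _ "of_real (norm z) / z"]) (simp add: norm_divide)
qed (auto intro: exI[of _ 1])

context banach_space_over
begin

lemma linear_imp_real_linear:
  assumes "Vector_Spaces.linear smul (*) f"
  shows "linear f"
proof -
  interpret f: Vector_Spaces.linear smul "(*)" f by fact
  show ?thesis
    by (rule linearI) (metis f.add, metis f.scale smul_of_real scaleR_conv_of_real)
qed

text \<open>Take a real functional \<open>f\<close> that norms \<open>x\<close> and let \<open>F y\<close> represent the functional
\<open>c \<mapsto> f (c y)\<close> on the scalars. Uniqueness of the representing scalar makes \<open>F\<close> linear over the scalars, and
rotating \<open>F y\<close> to a nonnegative real shows that its norm is at most that of \<open>f\<close>.\<close>

theorem norming_functional:
  "\<exists>F\<in>dual_space smul. norm F \<le> 1 \<and> norm (blinfun_apply F x) = norm x"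
proof -
  obtain f where f: "linear f" "\<And>z. f z \<le> norm z" "f x = norm x"
    using norming_real_functional by blast
  have "linear (\<lambda>c. f (smul c y))" for y
  proof (rule linearI)
    fix r b
    have "smul (r *\<^sub>R b) y = r *\<^sub>R smul b y"
      by (simp add: smul_of_real[symmetric] scaleR_conv_of_real)
    then show "f (smul (r *\<^sub>R b) y) = r *\<^sub>R f (smul b y)" by (simp add: linear_scale[OF f(1)])
  qed (simp add: scale_left_distrib linear_add[OF f(1)])
  then have "\<exists>z. \<forall>c. f (smul c y) = (c * z) \<bullet> 1" for y by (rule represent_by_mult_inner)
  then obtain F where F: "\<And>y c. f (smul c y) = (c * F y) \<bullet> 1" by metis
  have add: "F (y + z) = F y + F z" for y z
    by (rule mult_inner_one_eqD)
       (simp add: F[symmetric] scale_right_distrib linear_add[OF f(1)] distrib_left inner_add_left)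
  have scale: "F (smul c y) = c * F y" for c y
    by (rule mult_inner_one_eqD) (simp add: F[symmetric] mult.assoc[symmetric])
  have bound: "norm (F y) \<le> norm y" for y
  proof -
    obtain c where c: "norm c = 1" "(c * F y) \<bullet> 1 = norm (F y)" using ex_rotation by blast
    then have "norm (F y) \<le> norm (smul c y)" using f(2) F by metis
    then show ?thesis by (simp add: norm_smul c(1))
  qed
  have lin: "Vector_Spaces.linear smul (*) F"
    by unfold_locales (auto simp: add scale algebra_simps)
  have "bounded_linear F"
    using linear_imp_real_linear[OF lin] bound
    by (intro bounded_linear.intro bounded_linear_axioms.intro exI[of _ 1]) auto
  then have app: "blinfun_apply (Blinfun F) = F" by (rule bounded_linear_Blinfun_apply)
  have "Blinfun F \<in> dual_space smul" using lin by (simp add: dual_space_def app)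
  moreover have "norm (Blinfun F) \<le> 1" using bound by (intro norm_blinfun_bound) (auto simp: app)
  moreover have "norm x \<le> norm (F x)"
  proof -
    have "norm x = F x \<bullet> 1" using F[of 1 x] f(3) by simp
    also have "\<dots> \<le> norm (F x) * norm (1 :: 'k)" by (rule norm_cauchy_schwarz)
    finally show ?thesis by simp
  qed
  then have "norm (blinfun_apply (Blinfun F) x) = norm x" using bound[of x] by (simp add: app)
  ultimately show ?thesis by blast
qed

end

section \<open>Weak topologies given by a pairing\<close>

text \<open>A pairing through which \<open>'x\<close> is isometrically the whole dual of \<open>V\<close>: the last two assumptions say that
\<open>V\<close> norms \<open>'x\<close> and that every bounded functional on \<open>V\<close> is represented. There are two instances,
the pairing of a dual space with its predual and the pairing of a reflexive space with its dual.
Here \<open>V\<close> is a subset because the scalar-linear functionals form a proper subset of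
\<open>'x \<Rightarrow>\<^sub>L 'k\<close>.\<close>

locale norm_pairing =
  fixes B :: "'x::real_normed_vector \<Rightarrow> 'i::real_normed_vector \<Rightarrow> 'k::{real_normed_field, euclidean_space}"
    and sc :: "'k \<Rightarrow> 'i \<Rightarrow> 'i" and V :: "'i set"
  assumes V_add: "i \<in> V \<Longrightarrow> j \<in> V \<Longrightarrow> i + j \<in> V"
    and V_scale: "i \<in> V \<Longrightarrow> sc c i \<in> V"
    and B_diff: "i \<in> V \<Longrightarrow> B (x - y) i = B x i - B y i"
    and B_add: "i \<in> V \<Longrightarrow> j \<in> V \<Longrightarrow> B x (i + j) = B x i + B x j"
    and B_scale: "i \<in> V \<Longrightarrow> B x (sc c i) = c * B x i"
    and norm_sc: "i \<in> V \<Longrightarrow> norm (sc c i) = norm c * norm i"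
    and B_bound: "i \<in> V \<Longrightarrow> norm (B x i) \<le> norm x * norm i"
    and B_norming: "r < norm x \<Longrightarrow> \<exists>i\<in>V. norm i \<le> 1 \<and> r < norm (B x i)"
    and represent: "0 \<le> R \<Longrightarrow> (\<And>i j. i \<in> V \<Longrightarrow> j \<in> V \<Longrightarrow> \<phi> (i + j) = \<phi> i + \<phi> j) \<Longrightarrow>
      (\<And>c i. i \<in> V \<Longrightarrow> \<phi> (sc c i) = c * \<phi> i) \<Longrightarrow>
      (\<And>i. i \<in> V \<Longrightarrow> norm (\<phi> i) \<le> R * norm i) \<Longrightarrow>
      \<exists>x. norm x \<le> R \<and> (\<forall>i\<in>V. \<phi> i = B x i)"
begin

text \<open>Values outside \<open>V\<close> are set to zero so that the coordinates range over a compact product even though the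
index type is larger than \<open>V\<close>.\<close>

definition coords :: "'x \<Rightarrow> 'i \<Rightarrow> 'k" where
  "coords x i = (if i \<in> V then B x i else 0)"

definition weak :: "'x topology" where
  "weak = pullback_topology UNIV coords euclidean"

lemma topspace_weak [simp]: "topspace weak = UNIV"
  by (simp add: weak_def topspace_pullback_topology)

lemma openin_weak: "openin weak U \<longleftrightarrow> (\<exists>O'. open O' \<and> U = coords -` O')"
  by (simp add: weak_def openin_pullback_topology)

text \<open>By representability, a ball is the set of all functionals with the corresponding bound. Its image is
therefore cut out of a product of compact sets by equations between coordinates.\<close>

lemma image_coords_cball:
  assumes "R \<ge> 0"
  shows "coords ` cball 0 R = {\<phi>. (\<forall>i. \<phi> i \<in> (if i \<in> V then cball 0 (R * norm i) else {0}))} \<inter>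
    {\<phi>. \<forall>i\<in>V. \<forall>j\<in>V. \<phi> (i + j) = \<phi> i + \<phi> j} \<inter> {\<phi>. \<forall>c. \<forall>i\<in>V. \<phi> (sc c i) = c * \<phi> i}"
  (is "?L = ?R1 \<inter> ?R2 \<inter> ?R3")
proof (intro equalityI subsetI)
  fix \<phi> assume "\<phi> \<in> ?L"
  then obtain x where x: "norm x \<le> R" "\<phi> = coords x" by auto
  have "norm (B x i) \<le> R * norm i" if "i \<in> V" for i
    using B_bound[OF that, of x] mult_right_mono[OF x(1) norm_ge_zero, of i] by linarith
  then show "\<phi> \<in> ?R1 \<inter> ?R2 \<inter> ?R3"
    by (auto simp: x(2) coords_def V_add V_scale B_add B_scale)
next
  fix \<phi> assume \<phi>: "\<phi> \<in> ?R1 \<inter> ?R2 \<inter> ?R3"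
  then have R1: "\<And>i. \<phi> i \<in> (if i \<in> V then cball 0 (R * norm i) else {0})" by blast
  have "\<exists>x. norm x \<le> R \<and> (\<forall>i\<in>V. \<phi> i = B x i)"
  proof (rule represent[OF assms])
    fix i assume "i \<in> V"
    then show "norm (\<phi> i) \<le> R * norm i" using R1[of i] by simp
  qed (use \<phi> in blast)+
  then obtain x where x: "norm x \<le> R" "\<forall>i\<in>V. \<phi> i = B x i" by blast
  have "\<phi> = coords x"
  proof
    fix i show "\<phi> i = coords x i" using x(2) R1[of i] by (auto simp: coords_def)
  qed
  then show "\<phi> \<in> ?L" using x(1) by auto
qed

text \<open>The theorem of Banach and Alaoglu for the pairing.\<close>

theorem compactin_weak_cball: "compactin weak (cball 0 R)"
proof (cases "R \<ge> 0")
  case True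
  have "compact (coords ` cball 0 R)"
    unfolding image_coords_cball[OF True]
  proof (intro compact_Int_closed)
    show "compact {\<phi>. (\<forall>i. \<phi> i \<in> (if i \<in> V then cball 0 (R * norm i) else {0 :: 'k}))}"
      by (rule compact_coordinatewise) simp
    show "closed {\<phi> :: 'i \<Rightarrow> 'k. \<forall>i\<in>V. \<forall>j\<in>V. \<phi> (i + j) = \<phi> i + \<phi> j}"
      unfolding Ball_def by (intro closed_Collect_all closed_Collect_imp open_Collect_const closed_Collect_eq
          continuous_on_add continuous_on_product_coordinates)
    show "closed {\<phi> :: 'i \<Rightarrow> 'k. \<forall>c. \<forall>i\<in>V. \<phi> (sc c i) = c * \<phi> i}"
      unfolding Ball_def by (intro closed_Collect_all closed_Collect_imp open_Collect_const closed_Collect_eq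
          continuous_on_mult continuous_on_const continuous_on_product_coordinates)
  qed
  show ?thesis
    unfolding compactin_def
  proof (intro conjI allI impI)
    fix \<U> assume \<U>: "Ball \<U> (openin weak) \<and> cball 0 R \<subseteq> \<Union>\<U>"
    then have "\<forall>U\<in>\<U>. \<exists>O'. open O' \<and> U = coords -` O'" by (simp add: openin_weak)
    then have "\<exists>P. \<forall>U\<in>\<U>. open (P U) \<and> U = coords -` P U" by (rule bchoice)
    then obtain P where P: "\<forall>U\<in>\<U>. open (P U) \<and> U = coords -` P U" by (rule exE)
    have "coords ` cball 0 R \<subseteq> (\<Union>U\<in>\<U>. P U)"
    proof safe
      fix x :: 'x assume "x \<in> cball 0 R"
      then obtain U where "U \<in> \<U>" "x \<in> U" using \<U> by blast
      then show "coords x \<in> (\<Union>U\<in>\<U>. P U)" using P by auto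
    qed
    then obtain \<F> where F: "\<F> \<subseteq> \<U>" "finite \<F>" "coords ` cball 0 R \<subseteq> (\<Union>U\<in>\<F>. P U)"
      by (rule compactE_image[OF \<open>compact (coords ` cball 0 R)\<close>, rotated]) (use P in auto)
    have "cball 0 R \<subseteq> \<Union>\<F>"
    proof
      fix x :: 'x assume "x \<in> cball 0 R"
      then obtain U where "U \<in> \<F>" "coords x \<in> P U" using F(3) by blast
      then show "x \<in> \<Union>\<F>" using P F(1) by blast
    qed
    then show "\<exists>\<F>. finite \<F> \<and> \<F> \<subseteq> \<U> \<and> cball 0 R \<subseteq> \<Union>\<F>" using F by blast
  qed simp
qed simp

lemma continuous_map_weak_coordinate:
  assumes "i \<in> V"
  shows "continuous_map weak euclideanreal (\<lambda>x. B x i \<bullet> 1)"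
proof -
  have "continuous_on UNIV (\<lambda>\<phi> :: 'i \<Rightarrow> 'k. \<phi> i \<bullet> 1)"
    by (intro continuous_on_inner continuous_on_const continuous_on_product_coordinates)
  then have "continuous_map euclidean euclideanreal (\<lambda>\<phi> :: 'i \<Rightarrow> 'k. \<phi> i \<bullet> 1)" by simp
  from continuous_map_pullback[OF this, of UNIV coords]
  show ?thesis using assms by (simp add: weak_def comp_def coords_def)
qed

lemma continuous_map_weak_adjoint:
  assumes S: "\<And>i. i \<in> V \<Longrightarrow> S i \<in> V" and T: "\<And>x i. i \<in> V \<Longrightarrow> B (T x) i = B x (S i)"
  shows "continuous_map weak weak T"
proof -
  have "continuous_on UNIV (\<lambda>\<phi> i. if i \<in> V then \<phi> (S i) else 0 :: 'k)"
  proof (rule continuous_on_coordinatewise_then_product)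
    fix i show "continuous_on UNIV (\<lambda>\<phi>. if i \<in> V then \<phi> (S i) else 0 :: 'k)"
      by (cases "i \<in> V") auto
  qed
  then have "continuous_map euclidean euclidean (\<lambda>\<phi> i. if i \<in> V then \<phi> (S i) else 0 :: 'k)" by simp
  from continuous_map_pullback[OF this, of UNIV coords]
  have "continuous_map weak euclidean ((\<lambda>\<phi> i. if i \<in> V then \<phi> (S i) else 0 :: 'k) \<circ> coords)"
    by (simp add: weak_def)
  also have "(\<lambda>\<phi> i. if i \<in> V then \<phi> (S i) else 0 :: 'k) \<circ> coords = coords \<circ> T"
    by (auto simp: fun_eq_iff coords_def S T)
  finally have "continuous_map weak (pullback_topology UNIV coords euclidean) T"
    by (rule continuous_map_pullback') simp
  then show ?thesis by (simp only: weak_def[symmetric])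
qed

lemma B_norming_real:
  assumes "r < norm x"
  shows "\<exists>i\<in>V. norm i \<le> 1 \<and> r < B x i \<bullet> 1"
proof -
  obtain i where i: "i \<in> V" "norm i \<le> 1" "r < norm (B x i)" using B_norming[OF assms] by blast
  obtain c where c: "norm c = 1" "(c * B x i) \<bullet> 1 = norm (B x i)" using ex_rotation by blast
  show ?thesis using i c V_scale[OF i(1), of c] norm_sc[OF i(1), of c] B_scale[OF i(1), of x c]
    by (intro bexI[of _ "sc c i"]) auto
qed

text \<open>For every point \<open>z\<close> of a countable dense set choose unit functionals that almost norm it. As functionals
of norm at most one are 1-Lipschitz, these countably many also norm every difference \<open>x - c\<close>, which determines the balls.\<close>

lemma countable_norming_family:
  assumes D: "countable D" "closure D = (UNIV :: 'x set)"
  shows "\<exists>G. countable G \<and> (\<forall>g\<in>G. continuous_map weak euclideanreal g) \<and>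
    (\<forall>c r. cball c r = {x. \<forall>g\<in>G. g x - g c \<le> r})"
proof -
  have "\<exists>i. i \<in> V \<and> norm i \<le> 1 \<and> norm z - 1 / real (Suc n) < B z i \<bullet> 1" for z and n :: nat
    using B_norming_real[of "norm z - 1 / real (Suc n)" z] by auto
  then have "\<exists>v. \<forall>z n. v z n \<in> V \<and> norm (v z n) \<le> 1 \<and> norm z - 1 / real (Suc n) < B z (v z n) \<bullet> 1"
    by (intro choice allI)
  then obtain v where v: "\<And>z n. v z n \<in> V" "\<And>z n. norm (v z n) \<le> 1"
    "\<And>z n. norm z - 1 / real (Suc n) < B z (v z n) \<bullet> 1" by blast
  define G where "G = (\<lambda>(z, n) x. B x (v z n) \<bullet> 1) ` (D \<times> UNIV)"
  have diff: "B x (v z n) \<bullet> 1 - B c (v z n) \<bullet> 1 = B (x - c) (v z n) \<bullet> 1" for x c z n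
    by (simp add: B_diff[OF v(1)] inner_diff_left)
  have le: "B x (v z n) \<bullet> 1 \<le> norm x" for x z n
  proof -
    have "B x (v z n) \<bullet> 1 \<le> norm (B x (v z n)) * norm (1 :: 'k)" by (rule norm_cauchy_schwarz)
    also have "\<dots> \<le> norm x * norm (v z n)" using B_bound[OF v(1)] by simp
    also have "\<dots> \<le> norm x" using v(2) by (simp add: mult_left_le)
    finally show ?thesis .
  qed
  have "countable G" unfolding G_def using D(1) by simp
  moreover have "\<forall>g\<in>G. continuous_map weak euclideanreal g"
    using continuous_map_weak_coordinate[OF v(1)] by (auto simp: G_def)
  moreover have "cball c r = {x. \<forall>g\<in>G. g x - g c \<le> r}" for c r
  proof (intro equalityI subsetI)
    fix x assume "x \<in> cball c r"
    then have "norm (x - c) \<le> r" by (simp add: dist_norm norm_minus_commute)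
    then show "x \<in> {x. \<forall>g\<in>G. g x - g c \<le> r}" using order_trans[OF le] by (auto simp: G_def diff)
  next
    fix x assume x: "x \<in> {x. \<forall>g\<in>G. g x - g c \<le> r}"
    have "norm (x - c) - r \<le> 3 / real (Suc n)" for n
    proof -
      let ?e = "1 / real (Suc n)"
      have "x - c \<in> closure D" using D(2) by simp
      then obtain z where z: "z \<in> D" "dist z (x - c) < ?e"
        using closure_approachable[of "x - c" D] by (metis of_nat_0_less_iff zero_less_Suc zero_less_divide_1_iff)
      have "norm (x - c) \<le> norm z + ?e"
        using z(2) norm_triangle_ineq2[of "x - c" z] by (simp add: dist_norm norm_minus_commute)
      also have "norm z \<le> B z (v z n) \<bullet> 1 + ?e" using v(3)[of z n] by linarith
      also have "B z (v z n) \<bullet> 1 = B (x - c) (v z n) \<bullet> 1 + B (z - (x - c)) (v z n) \<bullet> 1"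
        by (simp add: B_diff[OF v(1)] inner_diff_left)
      also have "B (x - c) (v z n) \<bullet> 1 \<le> r"
      proof -
        have "(\<lambda>x. B x (v z n) \<bullet> 1) \<in> G" unfolding G_def using z(1) by (intro image_eqI[of _ _ "(z, n)"]) auto
        then show ?thesis using x diff[of x z n c] by auto
      qed
      also have "B (z - (x - c)) (v z n) \<bullet> 1 \<le> ?e"
        using le[of "z - (x - c)" z n] z(2) by (simp add: dist_norm)
      finally show ?thesis by simp
    qed
    note bound = this
    have "\<not> norm (x - c) - r > 0"
    proof
      assume "norm (x - c) - r > 0"
      then obtain n where "1 / real (Suc n) < (norm (x - c) - r) / 3"
        using nat_approx_posE[of "(norm (x - c) - r) / 3"] by auto
      with bound[of n] show False by simp
    qed
    then show "x \<in> cball c r" by (simp add: dist_norm norm_minus_commute)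
  qed
  ultimately show ?thesis by (intro exI[of _ G]) blast
qed

text \<open>\<open>S\<close> is the operator of which \<open>T\<close> is the adjoint; it makes \<open>T\<close> continuous for the weak topology.\<close>

theorem invariant_probability_near_RRec:
  assumes D: "countable D" "closure D = (UNIV :: 'x set)"
    and S: "\<And>i. i \<in> V \<Longrightarrow> S i \<in> V" "\<And>x i. i \<in> V \<Longrightarrow> B (T x) i = B x (S i)"
    and T: "bounded_linear T" and x: "x \<in> RRec T" and r: "r > 0"
  shows "\<exists>\<mu>. invariant_probability T \<mu> \<and> 0 < measure \<mu> (cball x r)"
proof -
  obtain G where G: "countable G" "\<And>g. g \<in> G \<Longrightarrow> continuous_map weak euclideanreal g"
    "\<And>c r. cball c r = {x. \<forall>g\<in>G. g x - g c \<le> r}"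
    using countable_norming_family[OF D] by blast
  obtain C where C: "\<And>x. norm (T x) \<le> norm x * C" using bounded_linear.bounded[OF T] by blast
  show ?thesis
    by (rule invariant_probability_of_RRec[OF topspace_weak _ compactin_weak_cball G D _ _ x r, of C])
       (auto simp: C mult.commute[of C] intro!: linear_continuous_on T continuous_map_weak_adjoint[of S] S)
qed

end

section \<open>Dual spaces and reflexive spaces\<close>

lemma norm_pairing_dual:
  assumes "banach_space_over scaleX" and Y: "banach_space_over scaleY"
    and J: "dual_identification scaleX scaleY J"
  shows "norm_pairing (\<lambda>x. blinfun_apply (J x)) scaleY UNIV"
proof -
  interpret Y: banach_space_over scaleY by fact
  interpret J: Vector_Spaces.linear scaleX dual_scale J using J by (simp add: dual_identification_def)
  have nJ: "norm (J x) = norm x" for x using J by (simp add: dual_identification_def)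
  have rJ: "range J = dual_space scaleY" using J by (simp add: dual_identification_def)
  have lin: "Vector_Spaces.linear scaleY (*) (blinfun_apply (J x))" for x
    using rJ by (auto simp: dual_space_def)
  show ?thesis
  proof (rule norm_pairing.intro, goal_cases)
    case (3 i x y)
    show ?case by (simp add: J.diff blinfun.diff_left)
  next
    case (4 i j x)
    show ?case by (rule blinfun.add_right)
  next
    case (5 i x c)
    show ?case using lin[of x] unfolding Vector_Spaces.linear_iff by blast
  next
    case (6 i c)
    show ?case by (rule Y.norm_smul)
  next
    case (7 i x)
    show ?case using norm_blinfun[of "J x" i] unfolding nJ .
  next
    case (8 r x)
    show ?case
    proof (rule ccontr)
      assume "\<not> ?case"
      then have *: "norm (blinfun_apply (J x) i) \<le> r" if "norm i \<le> 1" for i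
        using that not_le by blast
      have r0: "0 \<le> r" using *[of 0] by simp
      have "norm (J x) \<le> r"
      proof (rule norm_blinfun_bound[OF r0])
        fix y
        show "norm (blinfun_apply (J x) y) \<le> r * norm y"
        proof (cases "y = 0")
          case False
          have "norm (blinfun_apply (J x) ((1 / norm y) *\<^sub>R y)) \<le> r" using False by (intro *) simp
          then show ?thesis using False by (simp add: blinfun.scaleR_right field_simps)
        qed simp
      qed
      with 8 nJ[of x] show False by simp
    qed
  next
    case (9 R \<phi>)
    have lin\<phi>: "Vector_Spaces.linear scaleY (*) \<phi>"
      by unfold_locales (auto simp: 9 algebra_simps)
    have "bounded_linear \<phi>"
      using Y.linear_imp_real_linear[OF lin\<phi>] 9(4)
      by (intro bounded_linear.intro bounded_linear_axioms.intro exI[of _ R]) (auto simp: mult.commute)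
    then have app: "blinfun_apply (Blinfun \<phi>) = \<phi>" by (rule bounded_linear_Blinfun_apply)
    then have "Blinfun \<phi> \<in> range J" unfolding rJ using lin\<phi> by (simp add: dual_space_def)
    then obtain x where x: "J x = Blinfun \<phi>" by (metis imageE)
    show ?case
    proof (intro exI[of _ x] conjI ballI)
      have "norm (Blinfun \<phi>) \<le> R"
        by (rule norm_blinfun_bound[OF 9(1)]) (simp add: app 9(4))
      then show "norm x \<le> R" using nJ[of x] x by simp
    qed (simp add: x app)
  qed auto
qed

lemma mem_dual_space:
  assumes "banach_space_over smul"
  shows "f \<in> dual_space smul \<longleftrightarrow> (\<forall>c x. blinfun_apply f (smul c x) = c * blinfun_apply f x)"
proof -
  interpret banach_space_over smul by fact
  have "vector_space ((*) :: 'a \<Rightarrow> 'a \<Rightarrow> 'a)" by unfold_locales (auto simp: algebra_simps)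
  then show ?thesis
    by (simp add: dual_space_def Vector_Spaces.linear_iff vector_space_axioms blinfun.add_right)
qed

lemma dual_scale_apply [simp]: "blinfun_apply (dual_scale c f) x = c * blinfun_apply f x"
  by (simp add: dual_scale_def)

lemma norm_dual_scale: "norm (dual_scale c f) = norm c * norm f"
proof -
  have le: "norm (dual_scale c f) \<le> norm c * norm f" for c and f :: "'a \<Rightarrow>\<^sub>L 'b"
  proof (rule norm_blinfun_bound)
    fix x show "norm (blinfun_apply (dual_scale c f) x) \<le> norm c * norm f * norm x"
      using mult_left_mono[OF norm_blinfun[of f x] norm_ge_zero[of c]] by (simp add: norm_mult mult.assoc)
  qed simp
  show ?thesis
  proof (cases "c = 0")
    case True
    then show ?thesis using le[of 0 f] by simp
  next
    case False
    have "dual_scale (inverse c) (dual_scale c f) = f"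
      using False by (intro blinfun_eqI) simp
    then have "norm f \<le> inverse (norm c) * norm (dual_scale c f)"
      using le[of "inverse c" "dual_scale c f"] by (simp only: norm_inverse)
    then have "norm c * norm f \<le> norm (dual_scale c f)" using False by (simp add: field_simps)
    with le[of c f] show ?thesis by simp
  qed
qed

text \<open>Reflexivity represents a functional on the dual by a point \<open>x\<close>; a functional that norms \<open>x\<close> then
shows that the norm of \<open>x\<close> obeys the same bound. Both norm conditions come from Hahn-Banach.\<close>

lemma norm_pairing_reflexive:
  assumes X: "banach_space_over scaleX" and refl: "reflexive_space scaleX"
  shows "norm_pairing (\<lambda>x f. blinfun_apply f x) dual_scale (dual_space scaleX)"
proof -
  interpret X: banach_space_over scaleX by fact
  note mem = mem_dual_space[OF X]
  show ?thesis
  proof (rule norm_pairing.intro, goal_cases)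
    case (1 f g)
    then show ?case by (simp add: mem blinfun.add_left distrib_left)
  next
    case (2 f c)
    then show ?case by (simp add: mem)
  next
    case (3 f x y)
    show ?case by (rule blinfun.diff_right)
  next
    case (4 f g x)
    show ?case by (rule blinfun.add_left)
  next
    case (5 f x c)
    show ?case by simp
  next
    case (6 f c)
    show ?case by (rule norm_dual_scale)
  next
    case (7 f x)
    show ?case using norm_blinfun[of f x] by (simp add: mult.commute)
  next
    case (8 r x)
    then show ?case using X.norming_functional[of x] by force
  next
    case (9 R \<phi>)
    have "bidual_functional scaleX \<phi>"
      unfolding bidual_functional_def using 9(2-4) by blast
    then obtain x where x: "\<And>f. f \<in> dual_space scaleX \<Longrightarrow> \<phi> f = blinfun_apply f x"
      using refl unfolding reflexive_space_def by blast
    obtain F where F: "F \<in> dual_space scaleX" "norm F \<le> 1" "norm (blinfun_apply F x) = norm x"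
      using X.norming_functional[of x] by blast
    have "norm x \<le> R * norm F" using 9(4)[OF F(1)] F(3) x[OF F(1)] by simp
    also have "\<dots> \<le> R" using F(2) 9(1) by (simp add: mult_left_le)
    finally show ?case using x by blast
  qed
qed

text \<open>The identification \<open>J\<close> is a linear isometry, so linearity and boundedness of \<open>T\<close> can be checked on the
functionals \<open>J (T x)\<close>, where they come from those of \<open>S\<close> and \<open>J\<close>.\<close>

lemma bounded_linear_adjoint:
  assumes X: "banach_space_over scaleX" and Y: "banach_space_over scaleY"
    and J: "dual_identification scaleX scaleY J" and S: "bounded_operator scaleY S" and T: "adjoint_of J T S"
  shows "bounded_linear T"
proof -
  interpret X: banach_space_over scaleX by fact
  interpret J: Vector_Spaces.linear scaleX dual_scale J using J by (simp add: dual_identification_def)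
  have nJ: "norm (J x) = norm x" for x using J by (simp add: dual_identification_def)
  have injJ: "x = y" if "J x = J y" for x y
    using nJ[of "x - y"] that by (simp add: J.diff)
  have T: "blinfun_apply (J (T x)) y = blinfun_apply (J x) (S y)" for x y
    using T by (simp add: adjoint_of_def)
  obtain C where C: "\<And>y. norm (S y) \<le> C * norm y" using S unfolding bounded_operator_def by blast
  have Jr: "J (r *\<^sub>R x) = r *\<^sub>R J x" for r x
    unfolding X.smul_of_real[symmetric] J.scale
    by (rule blinfun_eqI) (simp add: blinfun.scaleR_left scaleR_conv_of_real)
  show ?thesis
  proof (rule bounded_linear_intro[of T "\<bar>C\<bar>"])
    fix x y r
    show "T (x + y) = T x + T y"
      by (rule injJ, rule blinfun_eqI) (simp add: J.add T blinfun.add_left)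
    show "T (r *\<^sub>R x) = r *\<^sub>R T x"
      by (rule injJ, rule blinfun_eqI) (simp add: Jr T blinfun.scaleR_left)
    have "norm (J (T x)) \<le> norm x * \<bar>C\<bar>"
    proof (rule norm_blinfun_bound)
      fix y
      have "norm (blinfun_apply (J (T x)) y) \<le> norm x * norm (S y)"
        using norm_blinfun[of "J x" "S y"] by (simp add: T nJ)
      also have "\<dots> \<le> norm x * (\<bar>C\<bar> * norm y)"
        using C[of y] mult_right_mono[OF abs_ge_self[of C] norm_ge_zero[of y]] by (intro mult_left_mono) auto
      finally show "norm (blinfun_apply (J (T x)) y) \<le> norm x * \<bar>C\<bar> * norm y" by (simp add: mult.assoc)
    qed simp
    then show "norm (T x) \<le> norm x * \<bar>C\<bar>" by (simp add: nJ)
  qed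
qed

lemma bounded_linear_bounded_operator:
  assumes X: "banach_space_over scaleX" and T: "bounded_operator scaleX T"
  shows "bounded_linear T"
proof -
  interpret X: banach_space_over scaleX by fact
  interpret T: Vector_Spaces.linear scaleX scaleX T using T by (simp add: bounded_operator_def)
  obtain C where C: "\<And>y. norm (T y) \<le> C * norm y" using T unfolding bounded_operator_def by blast
  show ?thesis
    by (rule bounded_linear_intro[of T C])
       (auto simp: T.add C mult.commute[of _ C] T.scale X.smul_of_real[symmetric])
qed

section \<open>Recurrence and invariant measures\<close>

lemma FRec_subset_UFRec: "FRec T \<subseteq> UFRec T"
proof -
  have "lower_density A \<le> upper_density A" for A
    unfolding lower_density_def upper_density_def by (rule Liminf_le_Limsup) simp
  then show ?thesis unfolding FRec_def UFRec_def using less_le_trans by blast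
qed

lemma UFRec_subset_RRec: "UFRec T \<subseteq> RRec T"
proof -
  have "upper_density A \<le> upper_Banach_density A" for A
    unfolding upper_density_def upper_Banach_density_def
  proof (intro Limsup_mono always_eventually allI)
    fix N
    show "ereal (real (card (A \<inter> {0..N})) / real (N + 1)) \<le> (SUP m. ereal (real (card (A \<inter> {m..m + N})) / real (N + 1)))"
      by (rule SUP_upper2[of 0]) auto
  qed
  then show ?thesis unfolding RRec_def UFRec_def using less_le_trans by blast
qed

text \<open>The measures are mixed with geometric weights; any weights that are all positive would do.\<close>

lemma invariant_probability_mixture:
  fixes M :: "nat \<Rightarrow> 'x::topological_space measure"
  assumes M: "\<And>n. invariant_probability T (M n)" and T: "T \<in> borel_measurable borel"
  shows "\<exists>\<mu>. invariant_probability T \<mu> \<and>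
    (\<forall>n. \<forall>A\<in>sets borel. 0 < emeasure (M n) A \<longrightarrow> 0 < emeasure \<mu> A)"
proof -
  let ?p = "measure_pmf (geometric_pmf (1/2))"
  define \<mu> where "\<mu> = ?p \<bind> M"
  have sub: "M n \<in> space (subprob_algebra borel)" for n
    using M[of n] prob_space_imp_subprob_space by (auto simp: space_subprob_algebra invariant_probability_def)
  then have meas: "M \<in> measurable ?p (subprob_algebra borel)" 
    unfolding measurable_pmf_measure1 by (intro Pi_I)
  have em: "emeasure \<mu> A = (\<integral>\<^sup>+ n. emeasure (M n) A \<partial>?p)" if "A \<in> sets borel" for A
    unfolding \<mu>_def using meas that by (intro emeasure_bind) auto
  have sets: "sets \<mu> = sets borel"
    unfolding \<mu>_def using M by (intro sets_bind) (auto simp: invariant_probability_def)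
  have UNIV1: "emeasure (M n) UNIV = 1" for n
    using M[of n] prob_space.emeasure_space_1[of "M n"] sets_eq_imp_space_eq[of "M n" borel]
    by (simp add: invariant_probability_def)
  have "invariant_probability T \<mu>"
    unfolding invariant_probability_def
  proof (intro conjI ballI sets)
    show "prob_space \<mu>"
      using em[of UNIV] sets_eq_imp_space_eq[OF sets] by (intro prob_spaceI) (simp add: UNIV1)
    fix A :: "'x set" assume A: "A \<in> sets borel"
    then have "T -` A \<in> sets borel" using measurable_sets[OF T A] by simp
    with A show "emeasure \<mu> (T -` A) = emeasure \<mu> A"
      using M by (simp add: em invariant_probability_def)
  qed
  moreover have "0 < emeasure \<mu> A" if "A \<in> sets borel" "0 < emeasure (M n) A" for n A
  proof (rule ccontr)
    assume "\<not> 0 < emeasure \<mu> A"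
    then have "(\<integral>\<^sup>+ n. emeasure (M n) A \<partial>?p) = 0" using em[OF that(1)] by (simp add: not_gr_zero)
    then have "AE n in ?p. emeasure (M n) A = 0" by (subst (asm) nn_integral_0_iff_AE) auto
    then have "emeasure (M n) A = 0" by (simp add: AE_measure_pmf_iff set_pmf_geometric)
    with that(2) show False by simp
  qed
  ultimately show ?thesis by blast
qed

text \<open>Given invariant measures that charge the neighbourhoods of reiteratively recurrent points, everything else
follows from the fact that every invariant measure is concentrated on the frequently recurrent points: a set of positive
measure contains such a point. For a measure of full support, mix measures that charge the members of a
countable base.\<close>

theorem recurrence_equivalences:
  fixes T :: "'x::real_normed_vector \<Rightarrow> 'x"
  assumes D: "countable D" "closure D = (UNIV :: 'x set)" and T: "continuous_on UNIV T"
    and near: "\<And>x r. x \<in> RRec T \<Longrightarrow> r > 0 \<Longrightarrow>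
      \<exists>\<mu>. invariant_probability T \<mu> \<and> 0 < measure \<mu> (cball x r)"
  shows "closure (FRec T) = closure (RRec T) \<and>
     ((FRec T - {0} \<noteq> {} \<longleftrightarrow> UFRec T - {0} \<noteq> {}) \<and>
      (UFRec T - {0} \<noteq> {} \<longleftrightarrow> RRec T - {0} \<noteq> {}) \<and>
      (RRec T - {0} \<noteq> {} \<longleftrightarrow>
         (\<exists>\<mu>. invariant_probability T \<mu> \<and> \<mu> \<noteq> return borel 0))) \<and>
     ((frequently_recurrent T \<longleftrightarrow> U_frequently_recurrent T) \<and>
      (U_frequently_recurrent T \<longleftrightarrow> reiteratively_recurrent T) \<and>
      (reiteratively_recurrent T \<longleftrightarrow>
         (\<exists>\<mu>. invariant_probability T \<mu> \<and> full_support \<mu>)))"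
proof -
  note FU = FRec_subset_UFRec[of T] and UR = UFRec_subset_RRec[of T]
  have ex_FRec: "\<exists>x\<in>A. x \<in> FRec T"
    if \<mu>: "invariant_probability T \<mu>" and A: "A \<in> sets borel" "emeasure \<mu> A \<noteq> 0" for \<mu> A
  proof (rule ccontr)
    assume *: "\<not> ?thesis"
    have "AE x in \<mu>. x \<notin> A"
      using AE_frequently_recurrent[OF D T \<mu>] by (rule AE_mp) (use * in \<open>auto intro!: AE_I2\<close>)
    moreover have "A \<in> sets \<mu>" using \<mu> A by (simp add: invariant_probability_def)
    ultimately have "emeasure \<mu> A = 0" by (simp add: AE_iff_null_sets null_setsD1)
    with A(2) show False by simp
  qed
  have near': "\<exists>\<mu>. invariant_probability T \<mu> \<and> emeasure \<mu> U \<noteq> 0" if x: "x \<in> RRec T" "x \<in> U" "open U" for x U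
  proof -
    obtain r where r: "r > 0" "cball x r \<subseteq> U" using x(2,3) open_contains_cball by blast
    obtain \<mu> where \<mu>: "invariant_probability T \<mu>" "0 < measure \<mu> (cball x r)" using near[OF x(1) r(1)] by blast
    interpret prob_space \<mu> using \<mu>(1) by (simp add: invariant_probability_def)
    have "measure \<mu> (cball x r) \<le> measure \<mu> U"
      using \<mu>(1) r(2) x(3) by (intro finite_measure_mono) (auto simp: invariant_probability_def)
    then have "emeasure \<mu> U \<noteq> 0" using \<mu>(2) by (auto simp: measure_def)
    then show ?thesis using \<mu>(1) by blast
  qed
  have "RRec T \<subseteq> closure (FRec T)"
  proof
    fix x assume x: "x \<in> RRec T"
    show "x \<in> closure (FRec T)"
      unfolding closure_iff_nhds_not_empty
    proof (intro allI impI)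
      fix A U assume U: "U \<subseteq> A" "x \<in> U" "open U"
      obtain \<mu> where "invariant_probability T \<mu>" "emeasure \<mu> U \<noteq> 0" using near'[OF x U(2,3)] by blast
      then obtain y where "y \<in> U" "y \<in> FRec T" using ex_FRec U(3) by (meson borel_open)
      then show "FRec T \<inter> A \<noteq> {}" using U(1) by blast
    qed
  qed
  then have cl: "closure (FRec T) = closure (RRec T)"
    using closure_mono[OF subset_trans[OF FU UR]] closure_minimal[OF _ closed_closure] by blast
  have clU: "closure (UFRec T) = closure (RRec T)"
    using closure_mono[OF FU] closure_mono[OF UR] cl by blast
  have a: "FRec T - {0} \<noteq> {}" if "invariant_probability T \<mu>" "\<mu> \<noteq> return borel 0" for \<mu>
  proof -
    interpret prob_space \<mu> using that(1) by (simp add: invariant_probability_def)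
    have sets: "sets \<mu> = sets borel" using that(1) by (simp add: invariant_probability_def)
    have "emeasure \<mu> (- {0}) \<noteq> 0"
    proof
      assume "emeasure \<mu> (- {0}) = 0"
      then have "- {0} \<in> null_sets \<mu>" by (auto simp: null_sets_def sets)
      then have "AE x in \<mu>. x = 0" using AE_not_in[of "- {0}" \<mu>] by simp
      then have "\<mu> = return \<mu> 0" by (rule AE_eq_constD)
      then have "\<mu> = return borel 0" using return_cong[OF sets, of 0] by simp
      with that(2) show False by simp
    qed
    then show ?thesis using ex_FRec[OF that(1), of "- {0}"] by auto
  qed
  have b: "\<exists>\<mu>. invariant_probability T \<mu> \<and> \<mu> \<noteq> return borel 0" if ne: "RRec T - {0} \<noteq> {}"
  proof -
    obtain x where x: "x \<in> RRec T" "x \<noteq> 0" using ne by auto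
    obtain \<mu> where \<mu>: "invariant_probability T \<mu>" "emeasure \<mu> (- {0}) \<noteq> 0"
      using near'[OF x(1), of "- {0}"] x(2) by auto
    have "\<mu> \<noteq> return borel 0" using \<mu>(2) by (auto simp: emeasure_return)
    with \<mu>(1) show ?thesis by blast
  qed
  have c: "closure (RRec T) = UNIV" if \<mu>: "invariant_probability T \<mu>" "full_support \<mu>" for \<mu>
  proof -
    have "U \<inter> FRec T \<noteq> {}" if "open U" "U \<noteq> {}" for U
    proof -
      have "emeasure \<mu> U \<noteq> 0" using \<mu>(2) that by (auto simp: full_support_def)
      then show ?thesis using ex_FRec[OF \<mu>(1), of U] that(1) by auto
    qed
    then have "closure (FRec T) = UNIV"
      by (metis Compl_empty_eq closed_closure closure_subset disjoint_eq_subset_Compl double_complement inf.commute open_Compl)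
    with cl show ?thesis by simp
  qed
  have d: "\<exists>\<mu>. invariant_probability T \<mu> \<and> full_support \<mu>" if dense: "closure (RRec T) = UNIV"
  proof -
    \<comment> \<open>A countable base of the topology.\<close>
    define U where "U n = (case prod_decode n of (i, k) \<Rightarrow> ball (from_nat_into D i) (1 / real (Suc k)))" for n
    have "\<exists>\<mu>. invariant_probability T \<mu> \<and> emeasure \<mu> (U n) \<noteq> 0" for n
    proof -
      have U: "open (U n)" "U n \<noteq> {}" by (auto simp: U_def split: prod.split)
      then obtain x where "x \<in> U n" "x \<in> RRec T"
        using dense open_Int_closure_eq_empty[OF U(1), of "RRec T"] by auto
      then show ?thesis using near' U(1) by blast
    qed
    then have "\<exists>M. \<forall>n. invariant_probability T (M n) \<and> emeasure (M n) (U n) \<noteq> 0" by (intro choice allI)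
    then obtain M where M: "\<And>n. invariant_probability T (M n)" "\<And>n. emeasure (M n) (U n) \<noteq> 0" by blast
    obtain \<mu> where \<mu>: "invariant_probability T \<mu>"
      "\<And>n A. A \<in> sets borel \<Longrightarrow> 0 < emeasure (M n) A \<Longrightarrow> 0 < emeasure \<mu> A"
      using invariant_probability_mixture[where M = M, OF M(1) borel_measurable_continuous_onI[OF T]] by blast
    have "0 < emeasure \<mu> A" if A: "open A" "A \<noteq> {}" for A
    proof -
      obtain x where "x \<in> A" using A(2) by blast
      then obtain c k where c: "c \<in> D" "cball c (1 / real (Suc k)) \<subseteq> A"
        using ex_small_ball_from_dense[OF D(2) A(1)] by blast
      then have "ball c (1 / real (Suc k)) \<subseteq> A" using ball_subset_cball by blast
      moreover have "U (prod_encode (to_nat_on D c, k)) = ball c (1 / real (Suc k))"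
        using c(1) D(1) by (simp add: U_def)
      ultimately have *: "U (prod_encode (to_nat_on D c, k)) \<subseteq> A" by simp
      let ?n = "prod_encode (to_nat_on D c, k)"
      have "emeasure (M ?n) (U ?n) \<le> emeasure (M ?n) A"
        by (rule emeasure_mono[OF *]) (use M(1)[of ?n] A(1) in \<open>auto simp: invariant_probability_def\<close>)
      moreover have "0 < emeasure (M ?n) (U ?n)" using M(2)[of ?n] by (simp add: zero_less_iff_neq_zero)
      ultimately have "0 < emeasure (M ?n) A" by (rule less_le_trans[rotated])
      then show ?thesis using A(1) by (intro \<mu>(2)[of A ?n]) auto
    qed
    then show ?thesis using \<mu>(1) unfolding full_support_def by blast
  qed
  have A: "(FRec T - {0} \<noteq> {} \<longleftrightarrow> UFRec T - {0} \<noteq> {}) \<and>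
      (UFRec T - {0} \<noteq> {} \<longleftrightarrow> RRec T - {0} \<noteq> {}) \<and>
      (RRec T - {0} \<noteq> {} \<longleftrightarrow> (\<exists>\<mu>. invariant_probability T \<mu> \<and> \<mu> \<noteq> return borel 0))"
    using FU UR a b by blast
  have B: "(reiteratively_recurrent T \<longleftrightarrow> (\<exists>\<mu>. invariant_probability T \<mu> \<and> full_support \<mu>))"
    unfolding reiteratively_recurrent_def using c d by blast
  show ?thesis
    using cl clU A B
    by (simp only: frequently_recurrent_def U_frequently_recurrent_def reiteratively_recurrent_def)
qed

theorem theorem1p3:
  fixes scaleX :: "'k::{real_normed_field, euclidean_space} \<Rightarrow> 'x::banach \<Rightarrow> 'x"
    and scaleY :: "'k \<Rightarrow> 'y::banach \<Rightarrow> 'y"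
    and J :: "'x \<Rightarrow> 'y \<Rightarrow>\<^sub>L 'k"
    and S :: "'y \<Rightarrow> 'y" and T :: "'x \<Rightarrow> 'x"
  assumes "banach_space_over scaleX"
    and "separable_space (euclidean :: 'x topology)"
  shows
  "(banach_space_over scaleY \<and> dual_identification scaleX scaleY J \<and>
    bounded_operator scaleY S \<and> adjoint_of J T S \<longrightarrow>
     closure (FRec T) = closure (RRec T) \<and>
     ((FRec T - {0} \<noteq> {} \<longleftrightarrow> UFRec T - {0} \<noteq> {}) \<and>
      (UFRec T - {0} \<noteq> {} \<longleftrightarrow> RRec T - {0} \<noteq> {}) \<and>
      (RRec T - {0} \<noteq> {} \<longleftrightarrow>
         (\<exists>\<mu>. invariant_probability T \<mu> \<and> \<mu> \<noteq> return borel 0))) \<and>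
     ((frequently_recurrent T \<longleftrightarrow> U_frequently_recurrent T) \<and>
      (U_frequently_recurrent T \<longleftrightarrow> reiteratively_recurrent T) \<and>
      (reiteratively_recurrent T \<longleftrightarrow>
         (\<exists>\<mu>. invariant_probability T \<mu> \<and> full_support \<mu>)))) \<and>
   (reflexive_space scaleX \<and> bounded_operator scaleX T \<longrightarrow>
     closure (FRec T) = closure (RRec T) \<and>
     ((FRec T - {0} \<noteq> {} \<longleftrightarrow> UFRec T - {0} \<noteq> {}) \<and>
      (UFRec T - {0} \<noteq> {} \<longleftrightarrow> RRec T - {0} \<noteq> {}) \<and>
      (RRec T - {0} \<noteq> {} \<longleftrightarrow>
         (\<exists>\<mu>. invariant_probability T \<mu> \<and> \<mu> \<noteq> return borel 0))) \<and>
     ((frequently_recurrent T \<longleftrightarrow> U_frequently_recurrent T) \<and>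
      (U_frequently_recurrent T \<longleftrightarrow> reiteratively_recurrent T) \<and>
      (reiteratively_recurrent T \<longleftrightarrow>
         (\<exists>\<mu>. invariant_probability T \<mu> \<and> full_support \<mu>))))"
proof -
  interpret X: banach_space_over scaleX by (rule assms(1))
  obtain D :: "'x set" where D: "countable D" "closure D = UNIV"
    using assms(2) unfolding separable_space_def by auto
  show ?thesis
  proof ((rule conjI; rule impI), goal_cases)
    case 1
    then have Y: "banach_space_over scaleY" and J: "dual_identification scaleX scaleY J"
      and S: "bounded_operator scaleY S" and adj: "adjoint_of J T S" by blast+
    interpret norm_pairing "\<lambda>x. blinfun_apply (J x)" scaleY UNIV
      by (rule norm_pairing_dual[OF assms(1) Y J])
    have T: "bounded_linear T" by (rule bounded_linear_adjoint[OF assms(1) Y J S adj])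
    have "\<exists>\<mu>. invariant_probability T \<mu> \<and> 0 < measure \<mu> (cball x r)"
      if "x \<in> RRec T" "r > 0" for x r
      using adj by (intro invariant_probability_near_RRec[OF D, where S = S] T that)
        (auto simp: adjoint_of_def)
    then show ?case
      by (intro recurrence_equivalences[OF D linear_continuous_on[OF T]])
  next
    case 2
    then have refl: "reflexive_space scaleX" and bounded: "bounded_operator scaleX T" by blast+
    interpret norm_pairing "\<lambda>x f. blinfun_apply f x" dual_scale "dual_space scaleX"
      by (rule norm_pairing_reflexive[OF assms(1) refl])
    have T: "bounded_linear T" by (rule bounded_linear_bounded_operator[OF assms(1) bounded])
    have scale: "T (scaleX c x) = scaleX c (T x)" for c x
      using bounded unfolding bounded_operator_def by (simp add: Vector_Spaces.linear_iff)
    have "\<exists>\<mu>. invariant_probability T \<mu> \<and> 0 < measure \<mu> (cball x r)"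
      if "x \<in> RRec T" "r > 0" for x r
      by (intro invariant_probability_near_RRec[OF D, where S = "\<lambda>f. f o\<^sub>L Blinfun T"] T that)
        (auto simp: mem_dual_space[OF assms(1)] bounded_linear_Blinfun_apply[OF T] scale)
    then show ?case
      by (intro recurrence_equivalences[OF D linear_continuous_on[OF T]])
  qed
qed

end
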